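(* Let $T\subseteq\omega^{<\omega}$ be a computable tree such that for each $n$ there is a computable ordinal bounding the ordinal ranks of the elements of $T_n$, but there is no computable ordinal bounding the set of all ordinal ranks of elements of $T$. Then $\mathcal{A}(T)$ is computable and $SR(\mathcal{A}(T))=\omega_1^{CK}$.
   Context: $T_n$ is the set of nodes of $T$ of length $n$. Tree rank: $rk(\sigma)=0$ if $\sigma$ has no successors; for $\alpha>0$, $rk(\sigma)=\alpha$ if $\alpha$ is the least ordinal greater than $rk(\tau)$ for all successors $\tau$; nodes receiving no ordinal rank get rank $\infty$ (the "ordinal ranks" are those that are ordinals). $G_n$ is the set of finite subsets of $T_n$, an abelian group under symmetric difference $\triangle$; for distinct $n>0$ the empty set in $G_n$ is replaced by distinct new elements $id_n$, and $G_0=\{id_0\}$; $G=\bigcup_n G_n$. The predecessor map $p:G_{n+1}\to G_n$: for nonempty $a=\{t_1,\dots,t_k\}\in G_{n+1}$ with $t_j'$ the predecessor of $t_j$ in $T$, $p(a)=\{t_1'\}\triangle\cdots\triangle\{t_k'\}$ (with $\emptyset$ written $id_n$), and $p(id_{n+1})=id_n$. For $a\in G_n$, $b\in G_m$, let $k=\min\{m,n\}$, $a^*=p^{(n-k)}(a)$, $b^*=p^{(m-k)}(b)$, and $f_a(b)=a^*\triangle b^*$. $\mathcal{A}(T)=(G,(f_a)_{a\in G})$. Scott rank: $\overline{a}\equiv^0\overline{b}$ iff same quantifier-free formulas; for $\beta>0$, $\overline{a}\equiv^\beta\overline{b}$ iff for every $\gamma<\beta$, for every $c$ there is $d$ and for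 every $d$ there is $c$ with $\overline{a},c\equiv^\gamma\overline{b},d$; $SR(\overline{a})$ is the least $\beta$ such that $\overline{a}\equiv^\beta\overline{b}$ implies $\overline{b}$ is in the automorphism orbit of $\overline{a}$; $SR(\mathcal{M})$ is the least $\alpha$ with $SR(\overline{a})<\alpha$ for all tuples $\overline{a}$ of $\mathcal{M}$. *)

theory Defs
  imports Complex_Main "HOL-Library.Nat_Bijection"
begin

unbundle cardinal_syntax

section \<open>Recursive functions\<close>

datatype recf = Zero | Succ | Proj nat | Comp recf "recf list" | Prim recf recf | Mu recf

text \<open>
  \<open>rec_eval f xs y\<close>: the partial recursive function denoted by \<open>f\<close> converges on \<open>xs\<close> with
  value \<open>y\<close>.  Codes carry no arity; recursion and minimisation act on the first argument.
\<close>

inductive rec_eval :: "recf \<Rightarrow> nat list \<Rightarrow> nat \<Rightarrow> bool" where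
  Zero: "rec_eval Zero xs 0"
| Succ: "rec_eval Succ [x] (Suc x)"
| Proj: "i < length xs \<Longrightarrow> rec_eval (Proj i) xs (xs ! i)"
| Comp: "list_all2 (\<lambda>g y. rec_eval g xs y) gs ys \<Longrightarrow> rec_eval f ys z \<Longrightarrow> rec_eval (Comp f gs) xs z"
| Prim_0: "rec_eval f xs y \<Longrightarrow> rec_eval (Prim f g) (0 # xs) y"
| Prim_Suc: "rec_eval (Prim f g) (n # xs) y \<Longrightarrow> rec_eval g (n # y # xs) z \<Longrightarrow>
    rec_eval (Prim f g) (Suc n # xs) z"
| Mu: "rec_eval f (n # xs) 0 \<Longrightarrow> (\<forall>m<n. \<exists>k. rec_eval f (m # xs) (Suc k)) \<Longrightarrow>
    rec_eval (Mu f) xs n"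

definition computable_set :: "nat set \<Rightarrow> bool" where
  "computable_set A \<longleftrightarrow> (\<exists>f. \<forall>x. rec_eval f [x] (if x \<in> A then 1 else 0))"

definition computable_rel :: "nat rel \<Rightarrow> bool" where
  "computable_rel R \<longleftrightarrow> (\<exists>f. \<forall>x y. rec_eval f [x, y] (if (x, y) \<in> R then 1 else 0))"


section \<open>Countable ordinals\<close>

text \<open>
  A countable ordinal is an isomorphism class of well-orders whose field is a set of natural
  numbers.  Ranks of nodes of trees of finite sequences of naturals and Scott ranks of countable
  structures are countable ordinals, so no other ordinals are needed below.
\<close>

quotient_type ordinal = "nat rel" / partial: "\<lambda>r s. r =o s"
proof (rule part_equivpI)
  have "Well_order ({} :: nat rel)" by simp
  then show "\<exists>r :: nat rel. r =o r" using ordIso_reflexive by blast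
  show "symp (\<lambda>r s :: nat rel. r =o s)" by (auto intro: sympI ordIso_symmetric)
  show "transp (\<lambda>r s :: nat rel. r =o s)" by (auto intro: transpI ordIso_transitive)
qed

lemma ordIso_Well_orderD:
  assumes "r =o s"
  shows "Well_order r" "Well_order s"
  using assms by (auto simp: ordIso_def)

lemma ordinal_cases:
  obtains r where "x = abs_ordinal r" "Well_order r"
proof -
  have "\<exists>r. x = abs_ordinal r \<and> Well_order r"
  proof (rule ordinal.abs_induct)
    fix r :: "nat rel" assume "r =o r"
    from ordIso_Well_orderD(1)[OF this] show "\<exists>s. abs_ordinal r = abs_ordinal s \<and> Well_order s"
      by (intro exI[of _ r] conjI refl)
  qed
  with that show thesis by iprover
qed

instantiation ordinal :: "{zero, wellorder}"
begin

lift_definition zero_ordinal :: ordinal is "{}"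
  by (rule ordIso_reflexive) simp

lift_definition less_eq_ordinal :: "ordinal \<Rightarrow> ordinal \<Rightarrow> bool" is "\<lambda>r s. r \<le>o s"
  by (meson ordIso_symmetric ordIso_ordLeq_trans ordLeq_ordIso_trans)

lift_definition less_ordinal :: "ordinal \<Rightarrow> ordinal \<Rightarrow> bool" is "\<lambda>r s. r <o s"
  by (meson ordIso_symmetric ordIso_ordLess_trans ordLess_ordIso_trans)

instance
proof
  fix x y z :: ordinal
  show "x < y \<longleftrightarrow> x \<le> y \<and> \<not> y \<le> x"
    by transfer (auto dest!: ordIso_Well_orderD(1) simp: not_ordLeq_iff_ordLess ordLess_imp_ordLeq
        not_ordLess_ordLeq)
  show "x \<le> x"
    by transfer (rule ordLeq_reflexive[OF ordIso_Well_orderD(1)])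
  show "x \<le> y \<Longrightarrow> y \<le> z \<Longrightarrow> x \<le> z"
    by transfer (rule ordLeq_transitive)
  show "x \<le> y \<Longrightarrow> y \<le> x \<Longrightarrow> x = y"
    by transfer (simp add: ordIso_iff_ordLeq)
  show "x \<le> y \<or> y \<le> x"
    by transfer (rule ordLeq_total[OF ordIso_Well_orderD(1) ordIso_Well_orderD(1)])
next
  fix P :: "ordinal \<Rightarrow> bool" and a :: ordinal
  assume step: "\<And>x. (\<And>y. y < x \<Longrightarrow> P y) \<Longrightarrow> P x"
  have P_abs: "Well_order r \<longrightarrow> P (abs_ordinal r)" for r
  proof (induction r rule: wf_induct_rule[OF wf_ordLess])
    case (1 r)
    show ?case
    proof (rule impI, rule step)
      fix y assume r: "Well_order r" and y: "y < abs_ordinal r"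
      obtain s where s: "y = abs_ordinal s" "Well_order s"
        by (rule ordinal_cases)
      have "s <o r"
        using y less_ordinal.abs_eq[OF ordIso_reflexive[OF s(2)] ordIso_reflexive[OF r]]
        unfolding s(1) by (rule iffD1[rotated])
      from mp[OF 1[OF this] s(2)] show "P y" unfolding s(1) .
    qed
  qed
  obtain r where r: "a = abs_ordinal r" "Well_order r"
    by (rule ordinal_cases)
  show "P a" unfolding r(1) by (rule mp[OF P_abs r(2)])
qed

end

definition computable_ordinal :: "ordinal \<Rightarrow> bool" where
  "computable_ordinal \<alpha> \<longleftrightarrow> (\<exists>R. Well_order R \<and> computable_rel R \<and> \<alpha> = abs_ordinal R)"

definition omega1_CK :: ordinal where
  "omega1_CK = (LEAST \<alpha>. \<not> computable_ordinal \<alpha>)"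


section \<open>Trees and tree rank\<close>

definition is_tree :: "nat list set \<Rightarrow> bool" where
  "is_tree T \<longleftrightarrow> (\<forall>\<sigma> \<tau>. \<sigma> @ \<tau> \<in> T \<longrightarrow> \<sigma> \<in> T)"

definition computable_tree :: "nat list set \<Rightarrow> bool" where
  "computable_tree T \<longleftrightarrow> is_tree T \<and> computable_set (list_encode ` T)"

definition level :: "nat list set \<Rightarrow> nat \<Rightarrow> nat list set" where
  "level T n = {\<sigma> \<in> T. length \<sigma> = n}"

definition successors :: "nat list set \<Rightarrow> nat list \<Rightarrow> nat list set" where
  "successors T \<sigma> = {\<tau> \<in> T. \<exists>n. \<tau> = \<sigma> @ [n]}"

text \<open>
  \<open>has_rank T \<sigma> \<alpha>\<close>: the node \<open>\<sigma>\<close> has ordinal rank \<open>\<alpha>\<close>.  For a node without successors the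
  least strict upper bound is 0.  Nodes of rank \<open>\<infinity>\<close> are those related to no ordinal.
\<close>

inductive has_rank :: "nat list set \<Rightarrow> nat list \<Rightarrow> ordinal \<Rightarrow> bool" for T where
  "\<sigma> \<in> T \<Longrightarrow> (\<forall>\<tau> \<in> successors T \<sigma>. has_rank T \<tau> (r \<tau>)) \<Longrightarrow>
   (\<forall>\<tau> \<in> successors T \<sigma>. r \<tau> < \<alpha>) \<Longrightarrow>
   (\<forall>\<beta>. (\<forall>\<tau> \<in> successors T \<sigma>. r \<tau> < \<beta>) \<longrightarrow> \<alpha> \<le> \<beta>) \<Longrightarrow>
   has_rank T \<sigma> \<alpha>"


section \<open>Structures with unary functions and Scott rank\<close>

record ('i, 'a) ustruct =
  univ :: "'a set"
  syms :: "'i set"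
  app :: "'i \<Rightarrow> 'a \<Rightarrow> 'a"

datatype 'i trm = Var nat | App 'i "'i trm"

datatype 'i qf = Eq "'i trm" "'i trm" | Neg "'i qf" | Conj "'i qf" "'i qf"

text \<open>Terms and quantifier-free formulas in the variables \<open>0, \<dots>, n - 1\<close>.\<close>

primrec wf_trm :: "'i set \<Rightarrow> nat \<Rightarrow> 'i trm \<Rightarrow> bool" where
  "wf_trm S n (Var j) \<longleftrightarrow> j < n"
| "wf_trm S n (App i t) \<longleftrightarrow> i \<in> S \<and> wf_trm S n t"

primrec wf_qf :: "'i set \<Rightarrow> nat \<Rightarrow> 'i qf \<Rightarrow> bool" where
  "wf_qf S n (Eq s t) \<longleftrightarrow> wf_trm S n s \<and> wf_trm S n t"
| "wf_qf S n (Neg \<phi>) \<longleftrightarrow> wf_qf S n \<phi>"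
| "wf_qf S n (Conj \<phi> \<psi>) \<longleftrightarrow> wf_qf S n \<phi> \<and> wf_qf S n \<psi>"

primrec trm_val :: "('i, 'a) ustruct \<Rightarrow> 'a list \<Rightarrow> 'i trm \<Rightarrow> 'a" where
  "trm_val M as (Var j) = as ! j"
| "trm_val M as (App i t) = app M i (trm_val M as t)"

primrec sat :: "('i, 'a) ustruct \<Rightarrow> 'a list \<Rightarrow> 'i qf \<Rightarrow> bool" where
  "sat M as (Eq s t) \<longleftrightarrow> trm_val M as s = trm_val M as t"
| "sat M as (Neg \<phi>) \<longleftrightarrow> \<not> sat M as \<phi>"
| "sat M as (Conj \<phi> \<psi>) \<longleftrightarrow> sat M as \<phi> \<and> sat M as \<psi>"

definition qf_equiv :: "('i, 'a) ustruct \<Rightarrow> 'a list \<Rightarrow> 'a list \<Rightarrow> bool" where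
  "qf_equiv M as bs \<longleftrightarrow> length as = length bs \<and>
     (\<forall>\<phi>. wf_qf (syms M) (length as) \<phi> \<longrightarrow> (sat M as \<phi> \<longleftrightarrow> sat M bs \<phi>))"

function bf_equiv :: "('i, 'a) ustruct \<Rightarrow> ordinal \<Rightarrow> 'a list \<Rightarrow> 'a list \<Rightarrow> bool" where
  "bf_equiv M \<beta> as bs \<longleftrightarrow>
     (if \<beta> = 0 then qf_equiv M as bs
      else \<forall>\<gamma>. \<gamma> < \<beta> \<longrightarrow>
        (\<forall>c \<in> univ M. \<exists>d \<in> univ M. bf_equiv M \<gamma> (as @ [c]) (bs @ [d])) \<and>
        (\<forall>d \<in> univ M. \<exists>c \<in> univ M. bf_equiv M \<gamma> (as @ [c]) (bs @ [d])))"
  by pat_completeness auto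
termination
  by (relation "inv_image {(\<gamma>, \<beta>). \<gamma> < \<beta>} (\<lambda>(M, \<beta>, as, bs). \<beta>)") (auto intro: wf)

declare bf_equiv.simps [simp del]

definition automorphism :: "('i, 'a) ustruct \<Rightarrow> ('a \<Rightarrow> 'a) \<Rightarrow> bool" where
  "automorphism M h \<longleftrightarrow> bij_betw h (univ M) (univ M) \<and>
     (\<forall>i \<in> syms M. \<forall>x \<in> univ M. h (app M i x) = app M i (h x))"

definition tuple_scott_rank :: "('i, 'a) ustruct \<Rightarrow> 'a list \<Rightarrow> ordinal" where
  "tuple_scott_rank M as = (LEAST \<beta>. \<forall>bs \<in> lists (univ M). length bs = length as \<longrightarrow>
     bf_equiv M \<beta> as bs \<longrightarrow> (\<exists>h. automorphism M h \<and> bs = map h as))"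

definition scott_rank :: "('i, 'a) ustruct \<Rightarrow> ordinal" where
  "scott_rank M = (LEAST \<alpha>. \<forall>as \<in> lists (univ M). tuple_scott_rank M as < \<alpha>)"

text \<open>
  Computability of a structure whose symbols and elements are named by natural numbers: the
  symbols and the universe form computable sets and the functions are uniformly computable.
\<close>

definition computable_ustruct ::
    "('i \<Rightarrow> nat) \<Rightarrow> ('a \<Rightarrow> nat) \<Rightarrow> ('i, 'a) ustruct \<Rightarrow> bool" where
  "computable_ustruct cs cu M \<longleftrightarrow>
     inj_on cs (syms M) \<and> computable_set (cs ` syms M) \<and>
     inj_on cu (univ M) \<and> computable_set (cu ` univ M) \<and>
     (\<forall>i \<in> syms M. \<forall>x \<in> univ M. app M i x \<in> univ M) \<and>
     (\<exists>f. \<forall>i \<in> syms M. \<forall>x \<in> univ M. rec_eval f [cs i, cu x] (cu (app M i x)))"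


section \<open>The structure of a tree\<close>

text \<open>
  An element of level \<open>n\<close> is a pair of \<open>n\<close> and a finite set of nodes of length \<open>n\<close>; the level
  tag makes the empty sets distinct, so \<open>(n, {})\<close> is the identity of level \<open>n\<close>.
\<close>

type_synonym gelt = "nat \<times> nat list set"

definition G_level :: "nat list set \<Rightarrow> nat \<Rightarrow> gelt set" where
  "G_level T n = (if n = 0 then {(0, {})} else {(n, A) | A. finite A \<and> A \<subseteq> level T n})"

definition G :: "nat list set \<Rightarrow> gelt set" where
  "G T = (\<Union>n. G_level T n)"

text \<open>
  Level 0 consists of the identity only, hence predecessors of elements of level 1 are all
  equal to it.  The value at level 0 is irrelevant.
\<close>

fun gpred :: "gelt \<Rightarrow> gelt" where
  "gpred (Suc (Suc n), A) =
     (Suc n, Finite_Set.fold (\<lambda>t B. sym_diff {butlast t} B) {} A)"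
| "gpred (_, A) = (0, {})"

definition gop :: "gelt \<Rightarrow> gelt \<Rightarrow> gelt" where
  "gop a b = (let k = min (fst a) (fst b);
                  a' = (gpred ^^ (fst a - k)) a;
                  b' = (gpred ^^ (fst b - k)) b
              in (k, sym_diff (snd a') (snd b')))"

definition tree_struct :: "nat list set \<Rightarrow> (gelt, gelt) ustruct" where
  "tree_struct T = \<lparr>univ = G T, syms = G T, app = gop\<rparr>"

definition gcode :: "gelt \<Rightarrow> nat" where
  "gcode a = prod_encode (fst a, set_encode (list_encode ` snd a))"

end

theory Submission
  imports Defs "HOL-Library.Countable_Set"
begin

text \<open>
  An automorphism of the structure is determined by the images of the identities of the levels, so
  it is a translation by a sequence of elements \<open>g\<^sub>n\<close> of the levels \<open>n\<close> coherent under the predecessor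
  map.  Hence two tuples of maximal level \<open>n\<close> that agree on quantifier-free formulas differ by a
  translation by one element \<open>d\<close> of level \<open>n\<close>, and they lie in the same orbit iff \<open>d\<close> extends to
  an infinite coherent sequence, iff every node in \<open>d\<close> is unranked.  Since a single back-and-forth
  move may climb finitely many levels at once, the tuples are equivalent to order \<open>\<beta>\<close> iff all nodes
  in \<open>d\<close> have rank at least \<open>\<omega> \<cdot> \<beta>\<close>.  The Scott rank of a tuple of level \<open>n\<close> is therefore bounded
  in terms of the ordinal ranks of level \<open>n\<close>, while for computable \<open>\<alpha>\<close> a node of ordinal rank
  above \<open>\<omega> \<cdot> \<alpha>\<close>, which is again computable, yields a tuple of Scott rank at least \<open>\<alpha>\<close>.
\<close>

section \<open>Total recursive functions\<close>

text \<open>Only the existence of a code is recorded, and \<open>n\<close> fixes the length of the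
  argument list. Computability of a compound function is then proved by closure rules that follow
  its syntax.\<close>

definition recfn :: "nat \<Rightarrow> (nat list \<Rightarrow> nat) \<Rightarrow> bool" where
  "recfn n F \<longleftrightarrow> (\<exists>c. \<forall>xs. length xs = n \<longrightarrow> rec_eval c xs (F xs))"

lemma recfn_cong:
  assumes "recfn n F" "\<And>xs. length xs = n \<Longrightarrow> F xs = F' xs"
  shows "recfn n F'"
  using assms unfolding recfn_def by metis

lemma recfn_Comp:
  assumes F: "recfn (length Gs) F" and Gs: "\<And>G. G \<in> set Gs \<Longrightarrow> recfn n G"
  shows "recfn n (\<lambda>xs. F (map (\<lambda>G. G xs) Gs))"
proof -
  obtain f where f: "\<And>xs. length xs = length Gs \<Longrightarrow> rec_eval f xs (F xs)"
    using F unfolding recfn_def by blast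
  have "\<exists>c. \<forall>G\<in>set Gs. \<forall>xs. length xs = n \<longrightarrow> rec_eval (c G) xs (G xs)"
    using Gs unfolding recfn_def by metis
  then obtain c where c: "\<And>G xs. G \<in> set Gs \<Longrightarrow> length xs = n \<Longrightarrow> rec_eval (c G) xs (G xs)"
    by blast
  have "rec_eval (Comp f (map c Gs)) xs (F (map (\<lambda>G. G xs) Gs))" if "length xs = n" for xs
    by (rule rec_eval.Comp[OF _ f]) (auto simp: list_all2_conv_all_nth c that)
  then show ?thesis unfolding recfn_def by blast
qed

lemma recfn_nth: "i < n \<Longrightarrow> recfn n (\<lambda>xs. xs ! i)"
  unfolding recfn_def by (auto intro: rec_eval.Proj)

text \<open>Arguments can be permuted, dropped or computed before \<open>F\<close> is applied; this
  is what moves a recursion variable to the front, where \<open>Prim\<close> expects it.\<close>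

lemma recfn_subst:
  assumes F: "recfn m F" and len: "\<And>xs. length xs = n \<Longrightarrow> length (\<pi> xs) = m"
    and nth: "\<And>i. i < m \<Longrightarrow> recfn n (\<lambda>xs. \<pi> xs ! i)"
  shows "recfn n (\<lambda>xs. F (\<pi> xs))"
proof -
  have "recfn n (\<lambda>xs. F (map (\<lambda>G. G xs) (map (\<lambda>i xs. \<pi> xs ! i) [0..<m])))"
    by (rule recfn_Comp) (use F nth in auto)
  then show ?thesis
  proof (rule recfn_cong)
    fix xs :: "nat list" assume "length xs = n"
    then have "map (\<lambda>i. \<pi> xs ! i) [0..<m] = \<pi> xs"
      using len[of xs] by (metis map_nth)
    then show "F (map (\<lambda>G. G xs) (map (\<lambda>i xs. \<pi> xs ! i) [0..<m])) = F (\<pi> xs)"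
      by (simp add: comp_def)
  qed
qed

lemma recfn_fun1:
  assumes "recfn 1 (\<lambda>xs. f (xs ! 0))" "recfn n g"
  shows "recfn n (\<lambda>xs. f (g xs))"
  using recfn_subst[OF assms(1), of n "\<lambda>xs. [g xs]"] assms(2) by simp

lemma recfn_fun2:
  assumes "recfn 2 (\<lambda>xs. f (xs ! 0) (xs ! 1))" "recfn n g" "recfn n h"
  shows "recfn n (\<lambda>xs. f (g xs) (h xs))"
proof -
  have "recfn n (\<lambda>xs. [g xs, h xs] ! i)" if "i < 2" for i
    using that assms(2,3) by (cases "i = 0") (auto simp: less_2_cases_iff)
  from recfn_subst[OF assms(1) _ this] show ?thesis by simp
qed

text \<open>Inside a recursion or bounded sum the outer arguments appear as
  \<open>drop k xs\<close>, and under two nested binders as two drops; references to outer variables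
  are still projections.\<close>

lemma recfn_drop_nth: "k + i < n \<Longrightarrow> recfn n (\<lambda>xs. drop k xs ! i)"
  by (rule recfn_cong[OF recfn_nth[of "k + i"]]) auto

lemma recfn_drop_drop_nth: "j + k + i < n \<Longrightarrow> recfn n (\<lambda>xs. drop j (drop k xs) ! i)"
  by (rule recfn_cong[OF recfn_nth[of "j + k + i"]]) (auto simp: ac_simps)

lemma recfn_Suc:
  assumes "recfn n g" shows "recfn n (\<lambda>xs. Suc (g xs))"
proof (rule recfn_fun1[OF _ assms])
  show "recfn 1 (\<lambda>xs. Suc (xs ! 0))"
    unfolding recfn_def by (auto simp: length_Suc_conv intro!: exI[of _ Succ] rec_eval.Succ)
qed

lemma recfn_const: "recfn n (\<lambda>_. c)"
proof (induction c)
  case 0 show ?case unfolding recfn_def by (auto intro: rec_eval.Zero)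
qed (rule recfn_Suc)

lemma recfn_rec_nat:
  assumes b: "recfn n b" and s: "recfn (n + 2) (\<lambda>ys. s (ys ! 0) (ys ! 1) (drop 2 ys))"
    and t: "recfn n t"
  shows "recfn n (\<lambda>xs. rec_nat (b xs) (\<lambda>k r. s k r xs) (t xs))"
proof -
  obtain cb where cb: "\<And>xs. length xs = n \<Longrightarrow> rec_eval cb xs (b xs)"
    using b unfolding recfn_def by blast
  obtain cs where cs: "\<And>ys. length ys = n + 2 \<Longrightarrow> rec_eval cs ys (s (ys ! 0) (ys ! 1) (drop 2 ys))"
    using s unfolding recfn_def by blast
  have "rec_eval (Prim cb cs) (k # xs) (rec_nat (b xs) (\<lambda>k r. s k r xs) k)"
    if "length xs = n" for k xs
  proof (induction k)
    case 0 show ?case using cb[OF that] by (auto intro: rec_eval.Prim_0)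
  next
    case (Suc k)
    show ?case
      by (rule rec_eval.Prim_Suc[OF Suc.IH]) (use cs[of "k # _ # xs"] that in \<open>simp add: numeral_2_eq_2\<close>)
  qed
  \<comment> \<open>\<open>Prim\<close> recurses on the head of the argument list; substituting
    \<open>t xs\<close> for the head yields recursion up to an arbitrary term.\<close>
  then have "recfn (Suc n) (\<lambda>ys. rec_nat (b (tl ys)) (\<lambda>k r. s k r (tl ys)) (hd ys))"
    unfolding recfn_def by (auto simp: length_Suc_conv intro!: exI[of _ "Prim cb cs"])
  from recfn_subst[OF this, of n "\<lambda>xs. t xs # xs"]
  have "(\<And>i. i < Suc n \<Longrightarrow> recfn n (\<lambda>xs. (t xs # xs) ! i)) \<Longrightarrow> ?thesis" by simp
  moreover have "recfn n (\<lambda>xs. (t xs # xs) ! i)" if "i < Suc n" for i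
    using t that by (cases i) (auto intro: recfn_nth)
  ultimately show ?thesis by blast
qed

lemmas recfn_basic = recfn_nth recfn_drop_nth recfn_drop_drop_nth recfn_const recfn_Suc

lemma recfn_add: "recfn n f \<Longrightarrow> recfn n g \<Longrightarrow> recfn n (\<lambda>xs. f xs + g xs)"
proof (rule recfn_fun2[where f = "(+)"])
  have "recfn 2 (\<lambda>xs. rec_nat (xs ! 1) (\<lambda>k r. Suc r) (xs ! 0))"
    by (intro recfn_rec_nat recfn_basic) simp_all
  moreover have "rec_nat b (\<lambda>k r. Suc r) a = a + b" for a b :: nat by (induction a) auto
  ultimately show "recfn 2 (\<lambda>xs. xs ! 0 + xs ! 1)" by simp
qed

lemma recfn_sum:
  assumes "recfn (n + 1) (\<lambda>ys. s (ys ! 0) (drop 1 ys))" "recfn n t"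
  shows "recfn n (\<lambda>xs. \<Sum>k<t xs. s k xs)"
proof -
  \<comment> \<open>In the recursion body the accumulator sits at position 1; the reindexing hides
    it from the summand.\<close>
  have "recfn (n + 2) (\<lambda>ys. (ys ! 0 # drop 2 ys) ! i)" if "i < n + 1" for i
    using that by (cases i) (auto intro!: recfn_basic)
  from recfn_subst[OF assms(1) _ this] have "recfn (n + 2) (\<lambda>ys. s (ys ! 0) (drop 2 ys))"
    by simp
  then have "recfn n (\<lambda>xs. rec_nat 0 (\<lambda>k r. r + s k xs) (t xs))"
    by (intro recfn_rec_nat recfn_add recfn_basic assms) simp_all
  moreover have "rec_nat 0 (\<lambda>k r. r + f k) a = (\<Sum>k<a. f k)" for f :: "nat \<Rightarrow> nat" and a
    by (induction a) auto
  ultimately show ?thesis by simp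
qed

lemma recfn_mult: "recfn n f \<Longrightarrow> recfn n g \<Longrightarrow> recfn n (\<lambda>xs. f xs * g xs)"
proof (rule recfn_fun2[where f = "(*)"])
  have "recfn 2 (\<lambda>xs. \<Sum>k<xs ! 0. xs ! 1)"
    by (intro recfn_sum recfn_basic) simp_all
  then show "recfn 2 (\<lambda>xs. xs ! 0 * xs ! 1)" by simp
qed

lemma recfn_diff: "recfn n f \<Longrightarrow> recfn n g \<Longrightarrow> recfn n (\<lambda>xs. f xs - g xs)"
proof (rule recfn_fun2[where f = "(-)"])
  have "recfn 1 (\<lambda>xs. rec_nat 0 (\<lambda>k r. k) (xs ! 0))"
    by (intro recfn_rec_nat recfn_basic) simp_all
  moreover have "rec_nat 0 (\<lambda>k r. k) a = a - 1" for a :: nat by (cases a) auto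
  ultimately have "recfn 1 (\<lambda>xs. xs ! 0 - 1)" by simp
  note pred = recfn_fun1[OF this]
  have "recfn 2 (\<lambda>xs. rec_nat (xs ! 0) (\<lambda>k r. r - 1) (xs ! 1))"
    by (intro recfn_rec_nat recfn_basic pred) simp_all
  moreover have "rec_nat a (\<lambda>k r. r - 1) b = a - b" for a b :: nat by (induction b) auto
  ultimately show "recfn 2 (\<lambda>xs. xs ! 0 - xs ! 1)" by simp
qed

lemma recfn_pow2: "recfn n f \<Longrightarrow> recfn n (\<lambda>xs. 2 ^ f xs)"
proof (rule recfn_fun1[where f = "\<lambda>x. 2 ^ x"])
  have "recfn 1 (\<lambda>xs. rec_nat 1 (\<lambda>k r. r + r) (xs ! 0))"
    by (intro recfn_rec_nat recfn_add recfn_basic) simp_all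
  moreover have "rec_nat 1 (\<lambda>k r. r + r) a = (2::nat) ^ a" for a by (induction a) auto
  ultimately show "recfn 1 (\<lambda>xs. 2 ^ (xs ! 0))" by simp
qed

section \<open>Decidable predicates and bounded quantification\<close>

definition decidable :: "nat \<Rightarrow> (nat list \<Rightarrow> bool) \<Rightarrow> bool" where
  "decidable n P \<longleftrightarrow> recfn n (\<lambda>xs. if P xs then 1 else 0)"

text \<open>With the 0/1 characteristic function \<open>\<chi>\<close> of \<open>P\<close>, the case
  distinction is \<open>\<chi> * f + (1 - \<chi>) * g\<close>.\<close>

lemma recfn_if:
  assumes "decidable n P" "recfn n f" "recfn n g"
  shows "recfn n (\<lambda>xs. if P xs then f xs else g xs)"
  by (rule recfn_cong[OF recfn_add[OF recfn_mult[OF assms(1)[unfolded decidable_def] assms(2)]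
    recfn_mult[OF recfn_diff[OF recfn_const[of _ 1] assms(1)[unfolded decidable_def]] assms(3)]]]) simp

lemma decidable_not: "decidable n P \<Longrightarrow> decidable n (\<lambda>xs. \<not> P xs)"
  using recfn_if[OF _ recfn_const[of _ 0] recfn_const[of _ 1], of n P]
  unfolding decidable_def[of n "\<lambda>xs. \<not> P xs"] by (auto elim: recfn_cong)

lemma decidable_conj: "decidable n P \<Longrightarrow> decidable n Q \<Longrightarrow> decidable n (\<lambda>xs. P xs \<and> Q xs)"
  using recfn_if[OF _ _ recfn_const[of _ 0], of n P "\<lambda>xs. if Q xs then 1 else 0"]
  unfolding decidable_def[of n "\<lambda>xs. P xs \<and> Q xs"] decidable_def[of n Q]
  by (auto elim: recfn_cong)

lemma decidable_disj: "decidable n P \<Longrightarrow> decidable n Q \<Longrightarrow> decidable n (\<lambda>xs. P xs \<or> Q xs)"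
  using decidable_not[OF decidable_conj[OF decidable_not[of n P] decidable_not[of n Q]]] by simp

lemma decidable_imp: "decidable n P \<Longrightarrow> decidable n Q \<Longrightarrow> decidable n (\<lambda>xs. P xs \<longrightarrow> Q xs)"
  using decidable_not[OF decidable_conj[of n P "\<lambda>xs. \<not> Q xs"]] decidable_not[of n Q] by simp

text \<open>Subtraction is truncated, so \<open>1 - (f - g)\<close> is the characteristic
  function.\<close>

lemma decidable_le: "recfn n f \<Longrightarrow> recfn n g \<Longrightarrow> decidable n (\<lambda>xs. f xs \<le> g xs)"
  unfolding decidable_def
  by (rule recfn_cong[OF recfn_diff[OF recfn_const[of _ 1] recfn_diff[of n f g]]]) auto

lemma decidable_eq: "recfn n f \<Longrightarrow> recfn n g \<Longrightarrow> decidable n (\<lambda>xs. f xs = g xs)"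
  using decidable_conj[OF decidable_le[of n f g] decidable_le[of n g f]] by (simp add: eq_iff)

text \<open>The number of counterexamples below the bound is a bounded sum, which is compared with
  0.\<close>

lemma decidable_all_less:
  assumes "decidable (n + 1) (\<lambda>ys. P (ys ! 0) (drop 1 ys))" "recfn n t"
  shows "decidable n (\<lambda>xs. \<forall>k<t xs. P k xs)"
proof -
  have "recfn n (\<lambda>xs. \<Sum>k<t xs. if P k xs then 0 else 1)"
    by (intro recfn_sum recfn_if recfn_basic assms)
  from decidable_eq[OF this recfn_const[of n 0]] show ?thesis
    by (simp add: if_split_eq1 lessThan_def)
qed

lemma decidable_fun1:
  assumes "decidable 1 (\<lambda>xs. P (xs ! 0))" "recfn n g"
  shows "decidable n (\<lambda>xs. P (g xs))"
  using recfn_fun1[OF assms[unfolded decidable_def]] unfolding decidable_def .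

lemma decidable_fun2:
  assumes "decidable 2 (\<lambda>xs. P (xs ! 0) (xs ! 1))" "recfn n g" "recfn n h"
  shows "decidable n (\<lambda>xs. P (g xs) (h xs))"
  using recfn_fun2[OF assms[unfolded decidable_def]] unfolding decidable_def .

lemmas recfn_arith = recfn_add recfn_mult recfn_diff recfn_pow2 recfn_if recfn_sum recfn_rec_nat
  decidable_not decidable_conj decidable_disj decidable_imp decidable_le
  decidable_eq decidable_all_less

lemma decidable_odd: "recfn n f \<Longrightarrow> decidable n (\<lambda>xs. odd (f xs))"
proof (rule decidable_fun1[where P = odd])
  have "decidable 1 (\<lambda>xs. rec_nat 0 (\<lambda>k r. 1 - r) (xs ! 0) = (1::nat))"
    by (intro recfn_arith recfn_basic) simp_all
  moreover have "rec_nat 0 (\<lambda>k r. 1 - r) a = (if odd a then 1 else 0 :: nat)" for a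
    by (induction a) auto
  ultimately show "decidable 1 (\<lambda>xs. odd (xs ! 0))" by (simp add: if_split_eq1)
qed

text \<open>The quotient counts the \<open>k\<close> for which \<open>Suc k\<close> copies of the
  divisor still fit.\<close>

lemma recfn_div: 
  assumes "recfn n f" "recfn n g" "\<And>xs. g xs > 0"
  shows "recfn n (\<lambda>xs. f xs div g xs)"
proof -
  have "recfn 2 (\<lambda>xs. \<Sum>k<xs ! 0. if Suc k * xs ! 1 \<le> xs ! 0 then 1 else 0)"
    by (intro recfn_arith recfn_basic) simp_all
  from recfn_fun2[OF this assms(1,2)]
  have "recfn n (\<lambda>xs. \<Sum>k<f xs. if Suc k * g xs \<le> f xs then 1 else 0)" .
  moreover have "(\<Sum>k<a. if Suc k * b \<le> a then 1 else 0) = a div b" if "b > 0" for a b :: nat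
  proof -
    have "Suc k * b \<le> a \<longleftrightarrow> k < a div b" for k
      using that by (metis Suc_le_eq less_eq_div_iff_mult_less_eq)
    moreover have "{..<a} \<inter> {k. k < a div b} = {..<a div b}"
      by (auto intro: less_le_trans)
    ultimately show ?thesis
      by (simp add: sum.If_cases)
  qed
  ultimately show ?thesis using assms(3) by simp
qed


section \<open>Codes of pairs and of finite sets\<close>

lemma recfn_prod_encode: "recfn n f \<Longrightarrow> recfn n g \<Longrightarrow> recfn n (\<lambda>xs. prod_encode (f xs, g xs))"
proof -
  assume fg: "recfn n f" "recfn n g"
  have "recfn n (\<lambda>xs. ((f xs + g xs) * Suc (f xs + g xs)) div 2 + f xs)"
    by (intro recfn_div recfn_arith recfn_basic fg) simp
  then show ?thesis by (simp add: prod_encode_def triangle_def)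
qed

definition pfst :: "nat \<Rightarrow> nat" where "pfst z = fst (prod_decode z)"
definition psnd :: "nat \<Rightarrow> nat" where "psnd z = snd (prod_decode z)"

lemma pfst_prod_encode [simp]: "pfst (prod_encode (a, b)) = a"
  and psnd_prod_encode [simp]: "psnd (prod_encode (a, b)) = b"
  by (simp_all add: pfst_def psnd_def)

lemma prod_encode_pfst_psnd [simp]: "prod_encode (pfst z, psnd z) = z"
  by (simp add: pfst_def psnd_def)

text \<open>Pairing is inverted by bounded search: both components are at most \<open>z\<close>, and
  exactly one pair in the range passes the test.\<close>

lemma prod_decode_sum:
  fixes v :: "nat \<Rightarrow> nat \<Rightarrow> nat"
  shows "(\<Sum>m<Suc z. \<Sum>n<Suc z. if prod_encode (m, n) = z then v m n else 0) = v (pfst z) (psnd z)"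
proof -
  have eq: "prod_encode (m, n) = z \<longleftrightarrow> m = pfst z \<and> n = psnd z" for m n
    by (metis pfst_prod_encode psnd_prod_encode prod_encode_pfst_psnd)
  have "pfst z < Suc z" "psnd z < Suc z"
    by (metis le_prod_encode_1 le_prod_encode_2 less_Suc_eq_le prod_encode_pfst_psnd)+
  then show ?thesis
    unfolding eq by (simp add: sum.If_cases if_distrib[of "sum _"] flip: sum.inter_filter if_if_eq_conj
      cong: if_cong del: sum.lessThan_Suc)
qed

lemma recfn_pfst: "recfn n f \<Longrightarrow> recfn n (\<lambda>xs. pfst (f xs))"
proof (rule recfn_fun1[where f = pfst])
  have "recfn 1 (\<lambda>xs. \<Sum>m<Suc (xs ! 0). \<Sum>n<Suc (xs ! 0). if prod_encode (m, n) = xs ! 0 then m else 0)"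
    by (intro recfn_prod_encode recfn_arith recfn_basic) simp_all
  then show "recfn 1 (\<lambda>xs. pfst (xs ! 0))" unfolding prod_decode_sum .
qed

lemma recfn_psnd: "recfn n f \<Longrightarrow> recfn n (\<lambda>xs. psnd (f xs))"
proof (rule recfn_fun1[where f = psnd])
  have "recfn 1 (\<lambda>xs. \<Sum>m<Suc (xs ! 0). \<Sum>n<Suc (xs ! 0). if prod_encode (m, n) = xs ! 0 then n else 0)"
    by (intro recfn_prod_encode recfn_arith recfn_basic) simp_all
  then show "recfn 1 (\<lambda>xs. psnd (xs ! 0))" unfolding prod_decode_sum .
qed

lemma decidable_set_decode: "recfn n f \<Longrightarrow> recfn n g \<Longrightarrow> decidable n (\<lambda>xs. f xs \<in> set_decode (g xs))"
  unfolding set_decode_def mem_Collect_eq by (intro decidable_odd recfn_div recfn_arith) simp_all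

text \<open>Turns bounded comprehension into a bounded sum, so that codes of finite sets can be
  computed.\<close>

lemma sum_pow2_eq_set_encode: "(\<Sum>y<b. if P y then 2 ^ y else 0) = set_encode {y. y < b \<and> P y}"
  by (simp add: set_encode_def sum.If_cases) (rule arg_cong2[where f = sum]; auto)

lemma recfn_set_encode_Collect:
  assumes "decidable (n + 1) (\<lambda>ys. P (ys ! 0) (drop 1 ys))" "recfn n t"
  shows "recfn n (\<lambda>xs. set_encode {y. y < t xs \<and> P y xs})"
  unfolding sum_pow2_eq_set_encode[symmetric] by (intro recfn_arith recfn_basic assms) simp

text \<open>Since \<open>2 ^ x \<le> S\<close> for every member \<open>x\<close>, quantifiers over a
  coded set are bounded by its code.\<close>

lemma set_decode_less: "x \<in> set_decode S \<Longrightarrow> x < S"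
proof -
  assume "x \<in> set_decode S"
  then have "S div 2 ^ x \<noteq> 0" by (auto simp: set_decode_def intro: ccontr)
  then have "2 ^ x \<le> S" by (metis div_less not_le)
  then show ?thesis by (rule less_le_trans[OF less_exp])
qed

lemma recfn_set_encode_sym_diff:
  assumes "recfn n f" "recfn n g"
  shows "recfn n (\<lambda>xs. set_encode (sym_diff (set_decode (f xs)) (set_decode (g xs))))"
proof -
  have "sym_diff (set_decode a) (set_decode b) =
      {y. y < a + b \<and> ((y \<in> set_decode a \<and> y \<notin> set_decode b) \<or> (y \<in> set_decode b \<and> y \<notin> set_decode a))}" for a b
    using set_decode_less[of _ a] set_decode_less[of _ b] by (force simp: trans_less_add1 trans_less_add2)
  moreover have "recfn 2 (\<lambda>xs. set_encode {y. y < xs ! 0 + xs ! 1 \<and>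
      ((y \<in> set_decode (xs ! 0) \<and> y \<notin> set_decode (xs ! 1)) \<or>
       (y \<in> set_decode (xs ! 1) \<and> y \<notin> set_decode (xs ! 0)))})"
    by (intro recfn_set_encode_Collect decidable_set_decode recfn_arith recfn_basic) simp_all
  ultimately have "recfn 2 (\<lambda>xs. set_encode (sym_diff (set_decode (xs ! 0)) (set_decode (xs ! 1))))"
    by simp
  from recfn_fun2[OF this assms] show ?thesis .
qed

section \<open>Codes of lists\<close>

definition code_drop :: "nat \<Rightarrow> nat \<Rightarrow> nat" where
  "code_drop k c = list_encode (drop k (list_decode c))"

lemma recfn_code_drop: "recfn n f \<Longrightarrow> recfn n g \<Longrightarrow> recfn n (\<lambda>xs. code_drop (f xs) (g xs))"
proof (rule recfn_fun2[where f = code_drop])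
  \<comment> \<open>A nonzero code is the successor of the pair of head and tail code, so each round
    passes to the tail; 0 codes the empty list.\<close>
  have "recfn 2 (\<lambda>xs. rec_nat (xs ! 1) (\<lambda>k r. if r = 0 then 0 else psnd (r - 1)) (xs ! 0))"
    by (intro recfn_psnd recfn_arith recfn_basic) simp_all
  moreover have "rec_nat c (\<lambda>k r. if r = 0 then 0 else psnd (r - 1)) k = code_drop k c" for k c
  proof (induction k)
    case (Suc k)
    have "(if list_encode l = 0 then 0 else psnd (list_encode l - 1)) = list_encode (drop 1 l)" for l
      by (cases l) auto
    from this[of "drop k (list_decode c)"] show ?case
      by (simp add: Suc code_drop_def)
  qed (simp add: code_drop_def)
  ultimately show "recfn 2 (\<lambda>xs. code_drop (xs ! 0) (xs ! 1))" by simp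
qed

lemma code_drop_eq_0_iff: "code_drop k c = 0 \<longleftrightarrow> length (list_decode c) \<le> k"
  unfolding code_drop_def by (metis drop_eq_Nil list_decode.simps(1) list_encode.simps(1) list_encode_inverse)

lemma length_le_list_encode: "length l \<le> list_encode l"
  by (induction l) (auto intro: order_trans[OF _ le_prod_encode_2])

definition code_length :: "nat \<Rightarrow> nat" where
  "code_length c = length (list_decode c)"

lemma recfn_code_length: "recfn n f \<Longrightarrow> recfn n (\<lambda>xs. code_length (f xs))"
proof (rule recfn_fun1[where f = code_length])
  have "recfn 1 (\<lambda>xs. \<Sum>k<xs ! 0. if code_drop k (xs ! 0) = 0 then 0 else 1)"
    by (intro recfn_code_drop recfn_arith recfn_basic) simp_all
  moreover have "(\<Sum>k<c. if code_drop k c = 0 then 0 else 1) = code_length c" for c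
  proof -
    have "{..<c} \<inter> {k. \<not> length (list_decode c) \<le> k} = {..<length (list_decode c)}"
      using length_le_list_encode[of "list_decode c"] by auto
    then show ?thesis
      by (simp add: code_drop_eq_0_iff sum.If_cases code_length_def Compl_eq)
  qed
  ultimately show "recfn 1 (\<lambda>xs. code_length (xs ! 0))" by simp
qed

text \<open>Pushing successive heads onto an accumulator reverses the prefix. Applying the operation
  twice restores the order, which gives \<open>code_butlast\<close>.\<close>

definition code_rev_take :: "nat \<Rightarrow> nat \<Rightarrow> nat" where
  "code_rev_take k c = list_encode (rev (take k (list_decode c)))"

lemma recfn_code_rev_take: "recfn n f \<Longrightarrow> recfn n g \<Longrightarrow> recfn n (\<lambda>xs. code_rev_take (f xs) (g xs))"
proof (rule recfn_fun2[where f = code_rev_take])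
  have "recfn 2 (\<lambda>xs. rec_nat 0 (\<lambda>k r. if code_drop k (xs ! 1) = 0 then r
      else Suc (prod_encode (pfst (code_drop k (xs ! 1) - 1), r))) (xs ! 0))"
    by (intro recfn_pfst recfn_code_drop recfn_prod_encode recfn_arith recfn_basic) simp_all
  moreover have "rec_nat 0 (\<lambda>k r. if code_drop k c = 0 then r
      else Suc (prod_encode (pfst (code_drop k c - 1), r))) k = code_rev_take k c" for k c
  proof (induction k)
    case (Suc k)
    show ?case
    proof (cases "k < length (list_decode c)")
      case True
      then have "code_drop k c = Suc (prod_encode (list_decode c ! k, code_drop (Suc k) c))"
        unfolding code_drop_def by (metis Cons_nth_drop_Suc list_encode.simps(2))
      with True show ?thesis by (simp add: Suc code_rev_take_def take_Suc_conv_app_nth)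
    qed (use Suc in \<open>simp add: code_drop_eq_0_iff code_rev_take_def\<close>)
  qed (simp add: code_rev_take_def)
  ultimately show "recfn 2 (\<lambda>xs. code_rev_take (xs ! 0) (xs ! 1))" by (simp only:)
qed

definition code_butlast :: "nat \<Rightarrow> nat" where
  "code_butlast c = list_encode (butlast (list_decode c))"

lemma recfn_code_butlast: "recfn n f \<Longrightarrow> recfn n (\<lambda>xs. code_butlast (f xs))"
proof (rule recfn_fun1[where f = code_butlast])
  have "recfn 1 (\<lambda>xs. code_rev_take (code_length (xs ! 0) - 1) (code_rev_take (code_length (xs ! 0) - 1) (xs ! 0)))"
    by (intro recfn_code_rev_take recfn_code_length recfn_arith recfn_basic) simp_all
  moreover have "code_rev_take (code_length c - 1) (code_rev_take (code_length c - 1) c) = code_butlast c" for c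
  proof -
    have "take (length l - 1) (rev (take (length l - 1) l)) = rev (butlast l)" for l :: "nat list"
      by (simp add: butlast_conv_take)
    then show ?thesis by (simp add: code_rev_take_def code_length_def code_butlast_def)
  qed
  ultimately show "recfn 1 (\<lambda>xs. code_butlast (xs ! 0))" by simp
qed

lemmas recfn_code = recfn_prod_encode recfn_pfst recfn_psnd decidable_set_decode
  recfn_set_encode_Collect recfn_set_encode_sym_diff recfn_code_length recfn_code_butlast

section \<open>Computable ordinals\<close>

lemma abs_ordinal_less_iff:
  "Well_order r \<Longrightarrow> Well_order s \<Longrightarrow> abs_ordinal r < abs_ordinal s \<longleftrightarrow> r <o s"
  by (rule less_ordinal.abs_eq) (auto intro: ordIso_reflexive)

lemma abs_ordinal_eqI: "r =o s \<Longrightarrow> abs_ordinal r = abs_ordinal s"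
  using Quotient_ordinal by (rule Quotient_rel_abs)

text \<open>Names the ordinals below \<open>abs_ordinal r\<close> by elements of the field of
  \<open>r\<close>, so that smaller ordinals can be handled inside one fixed well-order.\<close>

definition seg :: "nat rel \<Rightarrow> nat \<Rightarrow> ordinal" where
  "seg r a = abs_ordinal (Restr r (underS r a))"

lemma seg_less_abs_ordinal:
  assumes "Well_order r" "a \<in> Field r"
  shows "seg r a < abs_ordinal r"
  unfolding seg_def using assms
  by (auto simp: abs_ordinal_less_iff Well_order_Restr intro: underS_Restr_ordLess)

lemma seg_strict_mono:
  assumes r: "Well_order r" and ab: "(a, b) \<in> r" "a \<noteq> b"
  shows "seg r a < seg r b"
proof -
  have wo: "wo_rel r" using r by (simp add: wo_rel_def)
  have "underS r a \<subset> underS r b"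
  proof (rule psubsetI)
    show "underS r a \<subseteq> underS r b"
    proof (rule subsetI)
      fix x assume "x \<in> underS r a"
      then have x: "(x, a) \<in> r" "x \<noteq> a" by (auto simp: underS_def)
      have "(x, b) \<in> r" using wo_rel.TRANS[OF wo] x(1) ab(1) by (rule transD)
      moreover have "x \<noteq> b" using antisymD[OF wo_rel.ANTISYM[OF wo], of a b] ab x by auto
      ultimately show "x \<in> underS r b" by (simp add: underS_def)
    qed
    have "a \<in> underS r b" "a \<notin> underS r a" using ab by (auto simp: underS_def)
    then show "underS r a \<noteq> underS r b" by blast
  qed
  then show ?thesis
    unfolding seg_def using r
    by (simp add: abs_ordinal_less_iff Well_order_Restr ofilter_subset_ordLess[symmetric]
        wo_rel.underS_ofilter[OF wo])
qed

lemma less_abs_ordinalE: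
  assumes "x < abs_ordinal r" "Well_order r"
  obtains a where "a \<in> Field r" "x = seg r a"
proof -
  obtain s where s: "x = abs_ordinal s" "Well_order s" by (rule ordinal_cases)
  with assms obtain a where "a \<in> Field r" "s =o Restr r (underS r a)"
    by (auto simp: abs_ordinal_less_iff ordLess_iff_ordIso_Restr)
  with s that show thesis by (auto simp: seg_def intro: abs_ordinal_eqI)
qed

lemma countable_ordinal_lessThan: "countable {..<x::ordinal}"
proof -
  obtain r where r: "x = abs_ordinal r" "Well_order r" by (rule ordinal_cases)
  have "{..<x} \<subseteq> range (seg r)"
    using r by (auto elim: less_abs_ordinalE)
  then show ?thesis by (rule countable_subset) simp
qed

text \<open>
  If the ordinals were countable, their own order would be isomorphic to a well-order on a set of
  naturals, that is to the order of the ordinals below some \<open>\<alpha>\<close>.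
\<close>

lemma uncountable_UNIV_ordinal: "\<not> countable (UNIV :: ordinal set)"
proof
  assume "countable (UNIV :: ordinal set)"
  then obtain c :: "ordinal \<Rightarrow> nat" where c: "inj c" by (auto simp: countable_def)
  let ?le = "{(x :: ordinal, y). x \<le> y}"
  define R where "R = dir_image ?le c"
  have "Well_order ?le"
  proof -
    have "?le - Id = {(x, y). x < y}" by auto
    then have "wf (?le - Id)" using wf by simp
    moreover have "Field ?le = UNIV" by (auto simp: Field_def)
    ultimately show ?thesis
      by (auto simp: order_on_defs refl_on_def trans_def antisym_def total_on_def)
  qed
  then have R: "Well_order R"
    unfolding R_def by (rule Well_order_dir_image) (use c in \<open>auto intro: inj_on_subset\<close>)
  have mono: "seg R (c x) < seg R (c y)" if "x < y" for x y
  proof (rule seg_strict_mono[OF R])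
    show "(c x, c y) \<in> R" using that unfolding R_def dir_image_def by fastforce
    show "c x \<noteq> c y" using that c by (simp add: inj_eq)
  qed
  \<comment> \<open>A strictly increasing map on a well-order never falls below the identity. Since
    all its values are below \<open>abs_ordinal R\<close>, the choice
    \<open>x = abs_ordinal R\<close> is contradictory.\<close>
  have "x \<le> seg R (c x)" for x
  proof (induction x rule: less_induct)
    case (less x)
    show ?case
    proof (rule ccontr)
      assume "\<not> x \<le> seg R (c x)"
      then have lt: "seg R (c x) < x" by simp
      from less.IH[OF this] mono[OF this] show False by (rule notE[OF leD])
    qed
  qed
  moreover have "seg R (c x) < abs_ordinal R" for x
    by (rule seg_less_abs_ordinal[OF R]) (auto simp: R_def dir_image_def Field_def)
  ultimately show False by (meson not_le)
qed

text \<open>If a countable set were unbounded, the ordinals would be a countable union of countable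
  initial segments.\<close>

lemma countable_strictly_bounded:
  fixes A :: "ordinal set"
  assumes "countable A"
  obtains \<beta> where "\<And>x. x \<in> A \<Longrightarrow> x < \<beta>"
proof (rule ccontr)
  assume "\<not> thesis"
  with that have "\<exists>x\<in>A. \<beta> \<le> x" for \<beta> by (meson not_le)
  then have "UNIV = (\<Union>x\<in>A. insert x {..<x})" unfolding le_less by blast
  moreover have "countable (\<Union>x\<in>A. insert x {..<x})"
    using assms by (auto simp: countable_ordinal_lessThan)
  ultimately show False using uncountable_UNIV_ordinal by simp
qed

section \<open>Computable well-orders\<close>

lemma computable_rel_iff: "computable_rel R \<longleftrightarrow> decidable 2 (\<lambda>xs. (xs ! 0, xs ! 1) \<in> R)"
proof -
  have "(\<forall>xs. length xs = 2 \<longrightarrow> P xs) \<longleftrightarrow> (\<forall>x y. P [x, y])" for P :: "nat list \<Rightarrow> bool"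
    by (auto simp: length_Suc_conv numeral_2_eq_2)
  then show ?thesis by (simp add: computable_rel_def decidable_def recfn_def)
qed

lemma computable_rel_Restr_underS:
  assumes "computable_rel R"
  shows "computable_rel (Restr R (underS R a))"
proof -
  note R = decidable_fun2[where P = "\<lambda>x y. (x, y) \<in> R", OF assms[unfolded computable_rel_iff]]
  have "decidable 2 (\<lambda>xs. (xs ! 0, xs ! 1) \<in> R \<and> (xs ! 0 \<noteq> a \<and> (xs ! 0, a) \<in> R) \<and> (xs ! 1 \<noteq> a \<and> (xs ! 1, a) \<in> R))"
    by (intro R recfn_arith recfn_basic) simp_all
  then show ?thesis by (simp add: computable_rel_iff underS_def)
qed

text \<open>A smaller ordinal is the type of the initial segment below some \<open>a\<close>, and
  \<open>a\<close> enters the decision procedure as a constant.\<close>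

lemma computable_ordinal_le:
  assumes "computable_ordinal \<alpha>" "\<beta> \<le> \<alpha>"
  shows "computable_ordinal \<beta>"
proof (cases "\<beta> = \<alpha>")
  case False
  obtain R where R: "Well_order R" "computable_rel R" "\<alpha> = abs_ordinal R"
    using assms by (auto simp: computable_ordinal_def)
  with False assms obtain a where "\<beta> = seg R a"
    by (metis le_less less_abs_ordinalE)
  with R show ?thesis
    by (auto simp: computable_ordinal_def seg_def intro!: exI[of _ "Restr R (underS R a)"]
        Well_order_Restr computable_rel_Restr_underS)
qed (use assms in simp)

text \<open>The hypothesis makes the \<open>LEAST\<close> in \<open>omega1_CK\<close> a genuine
  minimum; closure of the computable ordinals under smaller ones does the rest.\<close>

lemma less_omega1_CK_iff:
  assumes "\<not> computable_ordinal \<alpha>"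
  shows "\<beta> < omega1_CK \<longleftrightarrow> computable_ordinal \<beta>"
proof
  show "\<beta> < omega1_CK \<Longrightarrow> computable_ordinal \<beta>"
    unfolding omega1_CK_def using not_less_Least by blast
  have "\<not> computable_ordinal omega1_CK"
    unfolding omega1_CK_def using assms by (rule LeastI)
  then show "computable_ordinal \<beta> \<Longrightarrow> \<beta> < omega1_CK"
    by (meson computable_ordinal_le not_le)
qed

text \<open>For \<open>R\<close> of type \<alpha> this has type \<omega> \<cdot> \<alpha>: each
  element of \<open>R\<close> is replaced by a copy of the naturals, and the code of
  \<open>(a, k)\<close> stands at position \<open>k\<close> of the copy at \<open>a\<close>.\<close>

definition omega_times :: "nat rel \<Rightarrow> nat rel" where
  "omega_times R = {(x, y). (pfst x, pfst y) \<in> R \<and> (pfst x = pfst y \<longrightarrow> psnd x \<le> psnd y)}"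

lemma computable_rel_omega_times:
  assumes "computable_rel R"
  shows "computable_rel (omega_times R)"
proof -
  note R = decidable_fun2[where P = "\<lambda>x y. (x, y) \<in> R", OF assms[unfolded computable_rel_iff]]
  have "decidable 2 (\<lambda>xs. (pfst (xs ! 0), pfst (xs ! 1)) \<in> R \<and>
      (pfst (xs ! 0) = pfst (xs ! 1) \<longrightarrow> psnd (xs ! 0) \<le> psnd (xs ! 1)))"
    by (intro R recfn_code recfn_arith recfn_basic) simp_all
  then show ?thesis by (simp add: computable_rel_iff omega_times_def)
qed

lemma Field_omega_times:
  assumes "Well_order R"
  shows "Field (omega_times R) = {x. pfst x \<in> Field R}"
  using wo_rel.REFL[of R] assms
  by (auto simp: omega_times_def Field_def wo_rel_def refl_on_def)

lemma Well_order_omega_times: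
  assumes R: "Well_order R"
  shows "Well_order (omega_times R)"
proof -
  interpret wo_rel R using R by (simp add: wo_rel_def)
  have eqI: "x = y" if "pfst x = pfst y" "psnd x = psnd y" for x y
    using that by (metis prod_encode_pfst_psnd)
  have "refl_on (Field (omega_times R)) (omega_times R)"
    using REFL unfolding Field_omega_times[OF R] by (auto simp: omega_times_def refl_on_def)
  moreover have "trans (omega_times R)"
  proof (rule transI)
    fix x y z assume xy: "(x, y) \<in> omega_times R" and yz: "(y, z) \<in> omega_times R"
    then have "(pfst x, pfst z) \<in> R" by (auto simp: omega_times_def intro: transD[OF TRANS])
    moreover have "pfst x = pfst y" "pfst y = pfst z" if "pfst x = pfst z"
      using xy yz that antisymD[OF ANTISYM, of "pfst x" "pfst y"] by (auto simp: omega_times_def)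
    ultimately show "(x, z) \<in> omega_times R" using xy yz by (auto simp: omega_times_def)
  qed
  moreover have "antisym (omega_times R)"
  proof (rule antisymI)
    fix x y assume xy: "(x, y) \<in> omega_times R" "(y, x) \<in> omega_times R"
    then have "pfst x = pfst y" by (auto simp: omega_times_def intro: antisymD[OF ANTISYM])
    with xy show "x = y" by (rule_tac eqI) (auto simp: omega_times_def)
  qed
  moreover have "total_on (Field (omega_times R)) (omega_times R)"
  proof (rule total_onI)
    fix x y assume "x \<in> Field (omega_times R)" "y \<in> Field (omega_times R)"
    then have "(pfst x, pfst y) \<in> R \<or> (pfst y, pfst x) \<in> R"
      using TOTALS unfolding Field_omega_times[OF R] by auto
    then show "(x, y) \<in> omega_times R \<or> (y, x) \<in> omega_times R"
      unfolding omega_times_def by (cases "pfst x = pfst y"; cases "psnd x \<le> psnd y"; simp)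
  qed
  moreover have "wf (omega_times R - Id)"
  proof (rule wf_subset)
    show "wf (inv_image ((R - Id) <*lex*> less_than) (\<lambda>z. (pfst z, psnd z)))"
      using WF by auto
    show "omega_times R - Id \<subseteq> inv_image ((R - Id) <*lex*> less_than) (\<lambda>z. (pfst z, psnd z))"
      by (auto simp: omega_times_def le_less dest: eqI)
  qed
  moreover have "omega_times R \<subseteq> Field (omega_times R) \<times> Field (omega_times R)"
    by (auto simp: Field_def)
  ultimately show ?thesis by (simp add: order_on_defs)
qed

lemma omega_times_coded:
  assumes "Well_order R"
  shows "(a, b) \<in> R \<Longrightarrow> a \<noteq> b \<Longrightarrow> (prod_encode (a, k), prod_encode (b, l)) \<in> omega_times R"
    and "a \<in> Field R \<Longrightarrow> k \<le> l \<Longrightarrow> (prod_encode (a, k), prod_encode (a, l)) \<in> omega_times R"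
  using wo_rel.REFL[of R] assms by (auto simp: omega_times_def wo_rel_def refl_on_def)

section \<open>The group operations\<close>

text \<open>Closed form of the iterated symmetric difference in \<open>gpred\<close>: a node
  survives iff the singletons containing it are odd in number.\<close>

definition branch_sum :: "nat list set \<Rightarrow> nat list set" where
  "branch_sum A = {s. odd (card {t \<in> A. butlast t = s})}"

lemma fold_eq_branch_sum:
  assumes "finite A"
  shows "Finite_Set.fold (\<lambda>t B. sym_diff {butlast t} B) {} A = branch_sum A"
proof -
  interpret comp_fun_commute "\<lambda>t B. sym_diff {butlast t :: nat list} B"
    by unfold_locales (auto simp: fun_eq_iff)
  show ?thesis using assms
  proof (induction A)
    case (insert x F)
    have "{t \<in> insert x F. butlast t = s} =
        (if butlast x = s then insert x {t \<in> F. butlast t = s} else {t \<in> F. butlast t = s})" for s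
      by auto
    then have "s \<in> branch_sum (insert x F) \<longleftrightarrow> s \<in> sym_diff {butlast x} (branch_sum F)" for s
      using insert.hyps by (simp add: branch_sum_def)
    then show ?case using insert by (simp add: set_eq_iff)
  qed (simp add: branch_sum_def)
qed

lemma odd_card_sym_diff:
  assumes "finite A" "finite B"
  shows "odd (card (sym_diff A B)) \<longleftrightarrow> odd (card A) \<noteq> odd (card B)"
proof -
  have "card (sym_diff A B) = card (A - B) + card (B - A)"
    using assms by (intro card_Un_disjoint) auto
  moreover have "card A = card (A - B) + card (A \<inter> B)"
    by (metis assms(1) card_Diff_subset_Int card_mono finite_Int inf_le1 le_add_diff_inverse2)
  moreover have "card B = card (B - A) + card (A \<inter> B)"
    by (metis Int_commute assms(2) card_Diff_subset_Int card_mono finite_Int inf_le1 le_add_diff_inverse2)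
  ultimately show ?thesis by presburger
qed

text \<open>Parity of cardinality is additive under symmetric difference; applied to each fibre of
  \<open>butlast\<close>, this makes the predecessor map a homomorphism.\<close>

lemma branch_sum_sym_diff:
  assumes "finite A" "finite B"
  shows "branch_sum (sym_diff A B) = sym_diff (branch_sum A) (branch_sum B)"
proof -
  have "{t \<in> sym_diff A B. butlast t = s} = sym_diff {t \<in> A. butlast t = s} {t \<in> B. butlast t = s}" for s
    by auto
  then show ?thesis
    using assms by (auto simp: branch_sum_def odd_card_sym_diff simp del: Un_Diff)
qed

lemma branch_sum_subset: "branch_sum A \<subseteq> butlast ` A"
proof
  fix s assume "s \<in> branch_sum A"
  then have "{t \<in> A. butlast t = s} \<noteq> {}" by (auto simp: branch_sum_def simp del: Collect_empty_eq)
  then show "s \<in> butlast ` A" by auto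
qed

lemma branch_sum_empty [simp]: "branch_sum {} = {}"
  by (simp add: branch_sum_def)

text \<open>When \<open>e\<close> chooses one child per node, all fibres are singletons and nothing
  cancels.\<close>

lemma branch_sum_image:
  assumes "\<And>t. t \<in> A \<Longrightarrow> butlast (e t) = t"
  shows "branch_sum (e ` A) = A"
proof -
  have "{t \<in> e ` A. butlast t = s} = (if s \<in> A then {e s} else {})" for s
    using assms by auto
  then show ?thesis by (auto simp: branch_sum_def)
qed

text \<open>The part of membership in \<open>G T\<close> that the algebra uses, stated without the
  tree.\<close>

definition gfin :: "gelt \<Rightarrow> bool" where
  "gfin a \<longleftrightarrow> finite (snd a) \<and> (fst a = 0 \<longrightarrow> snd a = {})"

definition gadd :: "gelt \<Rightarrow> gelt \<Rightarrow> gelt" where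
  "gadd a b = (fst a, sym_diff (snd a) (snd b))"

lemma fst_gadd [simp]: "fst (gadd a b) = fst a"
  by (simp add: gadd_def)

text \<open>The projection to level \<open>k\<close>. If \<open>k\<close> exceeds the level of
  \<open>a\<close>, truncated subtraction leaves \<open>a\<close> unchanged.\<close>

definition gres :: "nat \<Rightarrow> gelt \<Rightarrow> gelt" where
  "gres k a = (gpred ^^ (fst a - k)) a"

lemma gpred_eq:
  assumes "gfin a"
  shows "gpred a = (fst a - 1, if fst a \<le> 1 then {} else branch_sum (snd a))"
  using assms by (cases a rule: gpred.cases) (auto simp: gfin_def fold_eq_branch_sum)

lemma gfin_gpred: "gfin a \<Longrightarrow> gfin (gpred a)"
  by (auto simp: gpred_eq) (auto simp: gfin_def intro: finite_subset[OF branch_sum_subset])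

lemma gfin_gadd: "gfin a \<Longrightarrow> gfin b \<Longrightarrow> fst a = fst b \<Longrightarrow> gfin (gadd a b)"
  by (auto simp: gfin_def gadd_def)

lemma gpred_gadd:
  assumes "gfin a" "gfin b" "fst a = fst b"
  shows "gpred (gadd a b) = gadd (gpred a) (gpred b)"
  using assms gfin_gadd[OF assms]
  by (auto simp: gpred_eq branch_sum_sym_diff) (auto simp: gadd_def gfin_def branch_sum_sym_diff)

lemma gfin_funpow_gpred: "gfin a \<Longrightarrow> gfin ((gpred ^^ j) a)"
  by (induction j) (auto intro: gfin_gpred)

lemma fst_funpow_gpred: "gfin a \<Longrightarrow> fst ((gpred ^^ j) a) = fst a - j"
  by (induction j) (auto simp: gpred_eq gfin_funpow_gpred)

lemma funpow_gpred_gadd: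
  assumes "gfin a" "gfin b" "fst a = fst b"
  shows "(gpred ^^ j) (gadd a b) = gadd ((gpred ^^ j) a) ((gpred ^^ j) b)"
  by (induction j) (use assms in \<open>auto simp: gpred_gadd gfin_funpow_gpred fst_funpow_gpred\<close>)

lemma gfin_gres: "gfin a \<Longrightarrow> gfin (gres k a)"
  by (simp add: gres_def gfin_funpow_gpred)

lemma fst_gres: "gfin a \<Longrightarrow> k \<le> fst a \<Longrightarrow> fst (gres k a) = k"
  by (simp add: gres_def fst_funpow_gpred)

lemma gres_gres: "gfin a \<Longrightarrow> j \<le> k \<Longrightarrow> k \<le> fst a \<Longrightarrow> gres j (gres k a) = gres j a"
  by (simp add: gres_def fst_funpow_gpred flip: funpow_add[THEN fun_cong, unfolded comp_def])

lemma gres_gadd: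
  "gfin a \<Longrightarrow> gfin b \<Longrightarrow> fst a = fst b \<Longrightarrow> gres k (gadd a b) = gadd (gres k a) (gres k b)"
  by (simp add: gres_def funpow_gpred_gadd)

lemma gop_eq_gadd:
  assumes "gfin a" "gfin b"
  shows "gop a b = gadd (gres (min (fst a) (fst b)) a) (gres (min (fst a) (fst b)) b)"
  using assms by (simp add: gop_def gadd_def Let_def fst_gres flip: gres_def)

lemma fst_gop [simp]: "fst (gop a b) = min (fst a) (fst b)"
  by (simp add: gop_def Let_def)

lemma gfin_gop: "gfin a \<Longrightarrow> gfin b \<Longrightarrow> gfin (gop a b)"
  by (simp add: gop_eq_gadd gfin_gadd gfin_gres fst_gres)

lemma gres_gop:
  assumes "gfin a" "gfin b" "m \<le> fst a" "m \<le> fst b"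
  shows "gres m (gop a b) = gadd (gres m a) (gres m b)"
  using assms by (simp add: gop_eq_gadd gres_gadd gfin_gres fst_gres gres_gres)

lemma gadd_assoc: "gadd (gadd a b) c = gadd a (gadd b c)"
  by (auto simp: gadd_def)

lemma gop_commute: "gop a b = gop b a"
  by (simp add: gop_def Let_def min.commute Un_commute)

text \<open>Both sides project the three elements to their minimal level \<open>m\<close> and add
  them there; projection is a homomorphism and projections compose.\<close>

lemma gop_assoc:
  assumes "gfin a" "gfin b" "gfin c"
  shows "gop (gop a b) c = gop a (gop b c)"
proof -
  define m where "m = min (fst a) (min (fst b) (fst c))"
  have "gop (gop a b) c = gadd (gres m (gop a b)) (gres m c)"
    using assms by (subst gop_eq_gadd) (auto simp: gfin_gop m_def min.assoc)
  also have "\<dots> = gadd (gadd (gres m a) (gres m b)) (gres m c)"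
    using assms by (subst gres_gop) (auto simp: m_def)
  also have "\<dots> = gadd (gres m a) (gres m (gop b c))"
    using assms by (subst gres_gop) (auto simp: m_def gadd_assoc)
  also have "\<dots> = gop a (gop b c)"
    using assms by (subst (2) gop_eq_gadd) (auto simp: gfin_gop m_def)
  finally show ?thesis .
qed

lemma gop_left_commute:
  assumes "gfin a" "gfin b" "gfin c"
  shows "gop a (gop b c) = gop b (gop a c)"
  using assms gop_assoc[of a b c] gop_assoc[of b a c] by (simp add: gop_commute)

lemma gfin_id [simp]: "gfin (n, {})"
  by (simp add: gfin_def)

lemma gop_self: "gop a a = (fst a, {})"
  by (simp add: gop_def Let_def)

lemma gres_id: "gres k (n, {}) = (n - (n - k), {})"
proof -
  have "(gpred ^^ j) (n, {}) = (n - j, {})" for j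
    by (induction j) (auto simp: gpred_eq)
  then show ?thesis by (simp add: gres_def)
qed

text \<open>Identities act as projections, so the language of the structure itself can speak about
  levels and predecessors.\<close>

lemma gop_id:
  assumes "gfin x"
  shows "gop (n, {}) x = gres (min n (fst x)) x"
  using assms by (subst gop_eq_gadd) (auto simp: gres_id gadd_def fst_gres prod_eq_iff)

lemma gop_id_absorb: "gfin x \<Longrightarrow> fst x \<le> n \<Longrightarrow> gop (n, {}) x = x"
  by (simp add: gop_id min_def gres_def)

lemma gop_id_absorb_right: "gfin x \<Longrightarrow> fst x \<le> n \<Longrightarrow> gop x (n, {}) = x"
  using gop_id_absorb by (simp add: gop_commute)

lemma gop_id_eq_iff:
  assumes "gfin x"
  shows "gop (n, {}) x = x \<longleftrightarrow> fst x \<le> n"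
  using gop_id_absorb[OF assms] fst_gop[of "(n, {})" x] by (metis fst_conv min.cobounded1)

text \<open>Every element is its own inverse, so translation by \<open>d\<close> is an involution on
  the levels up to that of \<open>d\<close>.\<close>

lemma gop_cancel:
  assumes "gfin d" "gfin x" "fst x \<le> fst d"
  shows "gop d (gop d x) = x"
  using assms by (simp add: gop_assoc[symmetric] gop_self gop_id_absorb)

text \<open>Since \<open>x\<close> absorbs the identity of level \<open>n\<close>, translating it by
  \<open>d'\<close> depends only on the projection of \<open>d'\<close> to level
  \<open>n\<close>.\<close>

lemma gop_eqI_of_res:
  assumes "gfin d'" "gfin x" "gop (n, {}) d' = d" "fst x \<le> n"
  shows "gop d' x = gop d x"
proof -
  have "gop d x = gop d' (gop (n, {}) x)"
    using assms(1,2) by (simp add: gop_assoc gop_commute[of "(n, {})" d'] flip: assms(3))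
  then show ?thesis using assms by (simp add: gop_id_absorb)
qed

section \<open>Membership in \<open>G T\<close> and closure\<close>

lemma G_iff: "a \<in> G T \<longleftrightarrow> finite (snd a) \<and> snd a \<subseteq> level T (fst a) \<and> (fst a = 0 \<longrightarrow> snd a = {})"
  by (cases a) (auto simp: G_def G_level_def)

lemma G_gfin: "a \<in> G T \<Longrightarrow> gfin a"
  by (simp add: G_iff gfin_def)

lemma id_in_G [simp]: "(n, {}) \<in> G T"
  by (simp add: G_iff)

lemma G_nonempty: "G T \<noteq> {}"
  using id_in_G by blast

lemma gpred_in_G:
  assumes "is_tree T" "a \<in> G T"
  shows "gpred a \<in> G T"
proof -
  have "butlast t \<in> level T (fst a - 1)" if "t \<in> snd a" "\<not> fst a \<le> 1" for t
  proof -
    have t: "t \<in> T" "length t = fst a" using assms(2) that by (auto simp: G_iff level_def)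
    with that(2) have "butlast t @ [last t] \<in> T" by (metis append_butlast_last_id le0 list.size(3))
    then have "butlast t \<in> T" using assms(1) unfolding is_tree_def by blast
    then show ?thesis using t by (simp add: level_def)
  qed
  then show ?thesis
    using gfin_gpred[OF G_gfin[OF assms(2)]] branch_sum_subset[of "snd a"]
    by (fastforce simp: gpred_eq[OF G_gfin[OF assms(2)]] G_iff gfin_def)
qed

lemma gres_in_G:
  assumes "is_tree T" "a \<in> G T"
  shows "gres k a \<in> G T"
proof -
  have "(gpred ^^ j) a \<in> G T" for j
    by (induction j) (use assms in \<open>auto intro: gpred_in_G\<close>)
  then show ?thesis by (simp add: gres_def)
qed

lemma gop_in_G:
  assumes "is_tree T" "a \<in> G T" "b \<in> G T"
  shows "gop a b \<in> G T"
proof -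
  note gres = assms(2,3)[THEN gres_in_G[OF assms(1), of _ "min (fst a) (fst b)"]]
  with assms show ?thesis
    by (auto simp: gop_eq_gadd G_gfin) (auto simp: gadd_def G_iff fst_gres G_gfin)
qed

section \<open>Computability of the structure\<close>

lemma tree_struct_simps [simp]:
  "univ (tree_struct T) = G T" "syms (tree_struct T) = G T" "app (tree_struct T) = gop"
  by (simp_all add: tree_struct_def)

lemma computable_set_iff: "computable_set A \<longleftrightarrow> decidable 1 (\<lambda>xs. xs ! 0 \<in> A)"
proof -
  have "(\<forall>xs. length xs = 1 \<longrightarrow> P xs) \<longleftrightarrow> (\<forall>x. P [x])" for P :: "nat list \<Rightarrow> bool"
    by (auto simp: length_Suc_conv)
  then show ?thesis by (simp add: computable_set_def decidable_def recfn_def)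
qed

lemma pfst_gcode [simp]: "pfst (gcode a) = fst a"
  and psnd_gcode [simp]: "psnd (gcode a) = set_encode (list_encode ` snd a)"
  by (simp_all add: gcode_def)

lemma inj_on_gcode: "inj_on gcode (G T)"
proof (rule inj_onI)
  fix a b assume "a \<in> G T" "b \<in> G T" "gcode a = gcode b"
  then have "fst a = fst b" "list_encode ` snd a = list_encode ` snd b"
    by (auto simp: gcode_def G_iff set_encode_eq)
  then show "a = b" by (auto simp: prod_eq_iff inj_image_eq_iff inj_list_encode)
qed

text \<open>Puts the universe into decidable form: the quantifier over a coded set is bounded by its
  code. Level 0 is separate because it contains only the identity, whose set has code 0.\<close>

lemma gcode_image_iff:
  "z \<in> gcode ` G T \<longleftrightarrow> (pfst z = 0 \<and> psnd z = 0) \<or>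
    (pfst z \<noteq> 0 \<and> (\<forall>x<psnd z. x \<in> set_decode (psnd z) \<longrightarrow> x \<in> list_encode ` T \<and> code_length x = pfst z))"
    (is "_ \<longleftrightarrow> ?R")
proof
  assume "z \<in> gcode ` G T"
  then obtain a where "z = gcode a" "a \<in> G T" by blast
  then show ?R by (auto simp: G_iff level_def code_length_def)
next
  assume R: ?R
  define a where "a = (pfst z, list_decode ` set_decode (psnd z))"
  have "list_encode ` list_decode ` X = X" for X by (simp add: image_image)
  then have "z = gcode a" by (simp add: a_def gcode_def)
  moreover have "a \<in> G T"
  proof -
    have "list_decode x \<in> level T (pfst z)" if "x \<in> set_decode (psnd z)" for x
    proof -
      have "psnd z \<noteq> 0" using set_decode_less[OF that] by simp
      with R that set_decode_less[OF that] have "x \<in> list_encode ` T" "code_length x = pfst z" by auto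
      then show ?thesis by (auto simp: level_def code_length_def)
    qed
    then show ?thesis using R by (auto simp: a_def G_iff)
  qed
  ultimately show "z \<in> gcode ` G T" by blast
qed

lemma computable_set_gcode:
  assumes "computable_set (list_encode ` T)"
  shows "computable_set (gcode ` G T)"
proof -
  note T = decidable_fun1[where P = "\<lambda>x. x \<in> list_encode ` T", OF assms[unfolded computable_set_iff]]
  show ?thesis
    unfolding computable_set_iff gcode_image_iff
    by (intro T recfn_code recfn_arith recfn_basic) simp_all
qed

text \<open>Computes \<open>branch_sum\<close> on codes by counting fibres. The successor of the sum
  of all predecessor codes exceeds each of them and so bounds the output.\<close>

definition code_branch_sum :: "nat \<Rightarrow> nat" where
  "code_branch_sum S = set_encode {y. y < Suc (\<Sum>x<S. code_butlast x) \<and>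
     odd (\<Sum>x<S. if x \<in> set_decode S \<and> code_butlast x = y then 1 else 0 :: nat)}"

lemma recfn_code_branch_sum: "recfn n f \<Longrightarrow> recfn n (\<lambda>xs. code_branch_sum (f xs))"
proof (rule recfn_fun1[where f = code_branch_sum])
  show "recfn 1 (\<lambda>xs. code_branch_sum (xs ! 0))"
    unfolding code_branch_sum_def
    by (intro decidable_odd recfn_code recfn_arith recfn_basic) simp_all
qed

lemma code_branch_sum_set_encode:
  assumes "finite A"
  shows "code_branch_sum (set_encode (list_encode ` A)) = set_encode (list_encode ` branch_sum A)"
proof -
  define S where "S = set_encode (list_encode ` A)"
  have S: "set_decode S = list_encode ` A" using assms by (simp add: S_def)
  have count: "(\<Sum>x<S. if x \<in> set_decode S \<and> code_butlast x = list_encode s then 1 else 0 :: nat)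
      = card {t \<in> A. butlast t = s}" for s
  proof -
    have "{..<S} \<inter> {x. x \<in> set_decode S \<and> code_butlast x = list_encode s} = list_encode ` {t \<in> A. butlast t = s}"
      using set_decode_less[of _ S] by (auto simp: S code_butlast_def list_encode_eq)
    then show ?thesis by (simp add: sum.If_cases card_image inj_list_encode)
  qed
  have bound: "list_encode s < Suc (\<Sum>x<S. code_butlast x)" if s: "s \<in> branch_sum A" for s
  proof -
    obtain t where t: "t \<in> A" "s = butlast t" using s branch_sum_subset by blast
    then have "list_encode t < S" using set_decode_less[of _ S] S by auto
    then have "code_butlast (list_encode t) \<le> (\<Sum>x<S. code_butlast x)"
      by (intro member_le_sum) auto
    then show ?thesis using t by (simp add: code_butlast_def)
  qed
  have "{y. y < Suc (\<Sum>x<S. code_butlast x) \<and>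
     odd (\<Sum>x<S. if x \<in> set_decode S \<and> code_butlast x = y then 1 else 0 :: nat)} = list_encode ` branch_sum A"
    (is "?L = _")
  proof (rule set_eqI)
    fix y
    obtain s where y: "y = list_encode s" by (metis list_decode_inverse)
    have "y \<in> ?L \<longleftrightarrow> s \<in> branch_sum A"
      unfolding y mem_Collect_eq count using bound[of s] by (auto simp: branch_sum_def)
    then show "y \<in> ?L \<longleftrightarrow> y \<in> list_encode ` branch_sum A"
      unfolding y by (simp add: inj_image_mem_iff inj_list_encode)
  qed
  then show ?thesis unfolding code_branch_sum_def S_def by simp
qed

definition code_gpred :: "nat \<Rightarrow> nat" where
  "code_gpred z = prod_encode (pfst z - 1, if pfst z \<le> 1 then 0 else code_branch_sum (psnd z))"

lemma code_gpred_gcode: "gfin a \<Longrightarrow> code_gpred (gcode a) = gcode (gpred a)"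
  by (simp add: code_gpred_def gpred_eq code_branch_sum_set_encode gfin_def) (simp add: gcode_def)

lemma recfn_funpow_code_gpred:
  "recfn n f \<Longrightarrow> recfn n g \<Longrightarrow> recfn n (\<lambda>xs. (code_gpred ^^ f xs) (g xs))"
proof (rule recfn_fun2[where f = "\<lambda>j z. (code_gpred ^^ j) z"])
  have "recfn 2 (\<lambda>xs. rec_nat (xs ! 1) (\<lambda>k r. code_gpred r) (xs ! 0))"
    unfolding code_gpred_def by (intro recfn_code_branch_sum recfn_code recfn_arith recfn_basic) simp_all
  moreover have "rec_nat z (\<lambda>k r. code_gpred r) j = (code_gpred ^^ j) z" for z j
    by (induction j) auto
  ultimately show "recfn 2 (\<lambda>xs. (code_gpred ^^ (xs ! 0)) (xs ! 1))" by simp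
qed

definition code_gop :: "nat \<Rightarrow> nat \<Rightarrow> nat" where
  "code_gop z w = prod_encode (if pfst z \<le> pfst w then pfst z else pfst w,
     set_encode (sym_diff (set_decode (psnd ((code_gpred ^^ (pfst z - pfst w)) z)))
                          (set_decode (psnd ((code_gpred ^^ (pfst w - pfst z)) w)))))"

lemma code_gop_gcode:
  assumes "gfin a" "gfin b"
  shows "code_gop (gcode a) (gcode b) = gcode (gop a b)"
proof -
  have pow: "(code_gpred ^^ j) (gcode c) = gcode ((gpred ^^ j) c)" if "gfin c" for j c
    by (induction j) (use that in \<open>auto simp: code_gpred_gcode gfin_funpow_gpred\<close>)
  \<comment> \<open>Truncated subtraction lets \<open>code_gop\<close> write the numbers of
    predecessor steps without the minimum.\<close>
  have diff: "fst a - min (fst a) (fst b) = fst a - fst b" "fst b - min (fst a) (fst b) = fst b - fst a"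
    by auto
  have "finite (snd ((gpred ^^ j) c))" if "gfin c" for j c
    using gfin_funpow_gpred[OF that, of j] by (simp add: gfin_def)
  then show ?thesis
    using assms by (simp add: code_gop_def pow gop_def Let_def diff gcode_def[of "(_, _)"]
        image_Un image_set_diff[OF inj_list_encode] min_def)
qed

lemma computable_tree_struct:
  assumes "computable_tree T"
  shows "computable_ustruct gcode gcode (tree_struct T)"
proof -
  have tree: "is_tree T" using assms by (simp add: computable_tree_def)
  have "recfn 2 (\<lambda>xs. code_gop (xs ! 0) (xs ! 1))"
    unfolding code_gop_def
    by (intro recfn_funpow_code_gpred recfn_code recfn_arith recfn_basic) simp_all
  then obtain c where "\<And>xs. length xs = 2 \<Longrightarrow> rec_eval c xs (code_gop (xs ! 0) (xs ! 1))"
    unfolding recfn_def by blast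
  from this[of "[_, _]"] have "rec_eval c [x, y] (code_gop x y)" for x y by simp
  then have "\<forall>i\<in>G T. \<forall>x\<in>G T. rec_eval c [gcode i, gcode x] (gcode (gop i x))"
    by (metis G_gfin code_gop_gcode)
  then show ?thesis
    using assms computable_set_gcode[of T]
    by (auto simp: computable_ustruct_def inj_on_gcode computable_tree_def gop_in_G[OF tree])
qed

section \<open>Back-and-forth equivalence\<close>

text \<open>The level of the \<open>J\<close>-th entry is read off from which identities fix it.
  Writing a and b for entries of the two tuples, the symbol for the sum of a_j and a_J sends a_J to
  a_j. The same equation holds for b, so b_j is the sum of a_j, a_J and b_J.\<close>

lemma qf_equiv_imp_translate:
  assumes tree: "is_tree T" and as: "as \<in> lists (G T)" and bs: "bs \<in> lists (G T)"
    and J: "J < length as" and max: "\<And>a. a \<in> set as \<Longrightarrow> fst a \<le> fst (as ! J)"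
    and equiv: "qf_equiv (tree_struct T) as bs"
  shows "fst (bs ! J) = fst (as ! J)" and "bs = map (gop (gop (as ! J) (bs ! J))) as"
proof -
  have len: "length as = length bs"
    and eq: "wf_trm (G T) (length as) s \<Longrightarrow> wf_trm (G T) (length as) t \<Longrightarrow>
      trm_val (tree_struct T) as s = trm_val (tree_struct T) as t \<longleftrightarrow>
      trm_val (tree_struct T) bs s = trm_val (tree_struct T) bs t" for s t
    using equiv unfolding qf_equiv_def by (auto dest: spec[of _ "Eq s t"])
  have asG: "as ! j \<in> G T" "bs ! j \<in> G T" if "j < length as" for j
    using as bs that len by auto
  note fin = asG[THEN G_gfin]
  have "fst (as ! J) \<le> n \<longleftrightarrow> fst (bs ! J) \<le> n" for n
    using eq[of "App (n, {}) (Var J)" "Var J"] J by (simp add: gop_id_eq_iff fin)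
  then show "fst (bs ! J) = fst (as ! J)" by (metis eq_iff)
  show "bs = map (gop (gop (as ! J) (bs ! J))) as"
  proof (rule nth_equalityI)
    fix j assume "j < length bs"
    then have j: "j < length as" using len by simp
    \<comment> \<open>Maximality of the level of \<open>as ! J\<close> is used here: its square is
      the identity of that level, which \<open>as ! j\<close> absorbs.\<close>
    have "gop (gop (as ! j) (as ! J)) (as ! J) = as ! j"
      using max[of "as ! j"] j J by (simp add: gop_assoc fin gop_self gop_id_absorb_right)
    moreover have "gop (as ! j) (as ! J) \<in> G T" using asG j J by (auto intro: gop_in_G[OF tree])
    ultimately have "gop (gop (as ! j) (as ! J)) (bs ! J) = bs ! j"
      using eq[of "App (gop (as ! j) (as ! J)) (Var J)" "Var j"] j J by simp
    then show "bs ! j = map (gop (gop (as ! J) (bs ! J))) as ! j"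
      using gop_commute[of "gop (as ! J) (bs ! J)" "as ! j"] j J by (simp add: gop_assoc fin)
  qed (simp add: len)
qed

text \<open>Translation by \<open>d\<close> commutes with all functions of the structure, and it is
  injective on the levels up to that of \<open>d\<close>, which contain all term values.\<close>

lemma translate_imp_qf_equiv:
  assumes tree: "is_tree T" and d: "d \<in> G T" and as: "as \<in> lists (G T)"
    and le: "\<And>a. a \<in> set as \<Longrightarrow> fst a \<le> fst d"
  shows "qf_equiv (tree_struct T) as (map (gop d) as)"
proof -
  let ?M = "tree_struct T"
  have trm: "trm_val ?M as t \<in> G T \<and> fst (trm_val ?M as t) \<le> fst d \<and>
      trm_val ?M (map (gop d) as) t = gop d (trm_val ?M as t)"
    if "wf_trm (G T) (length as) t" for t
    using that
  proof (induction t)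
    case (Var j)
    then show ?case using as le by auto
  next
    case (App i t)
    then show ?case
      using d by (auto intro: gop_in_G[OF tree] gop_left_commute G_gfin min.coboundedI2)
  qed
  have inj: "x = y" if "gop d x = gop d y" "x \<in> G T" "y \<in> G T" "fst x \<le> fst d" "fst y \<le> fst d" for x y
    using that d by (metis G_gfin gop_cancel)
  have "sat ?M as \<phi> \<longleftrightarrow> sat ?M (map (gop d) as) \<phi>" if "wf_qf (G T) (length as) \<phi>" for \<phi>
    using that
  proof (induction \<phi>)
    case (Eq s t)
    then show ?case using trm[of s] trm[of t] inj[of "trm_val ?M as s" "trm_val ?M as t"] by auto
  qed auto
  then show ?thesis by (simp add: qf_equiv_def)
qed

lemma not_less_zero_ordinal: "\<not> x < (0 :: ordinal)"
proof
  assume "x < 0"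
  then have "x < abs_ordinal {}" by (simp add: zero_ordinal_def)
  then show False by (rule less_abs_ordinalE) auto
qed

lemma bf_equiv_forth:
  assumes "bf_equiv M \<beta> as bs" "\<gamma> < \<beta>" "c \<in> univ M"
  shows "\<exists>d\<in>univ M. bf_equiv M \<gamma> (as @ [c]) (bs @ [d])"
  using assms bf_equiv.simps[of M \<beta> as bs] not_less_zero_ordinal[of \<gamma>] by (metis (full_types))

text \<open>At positive order one arbitrary move is played, giving equivalence of order 0 for longer
  tuples; formulas over the shorter tuples ignore the appended entry.\<close>

lemma bf_equiv_imp_qf_equiv:
  assumes "bf_equiv M \<beta> as bs" "univ M \<noteq> {}" "length as = length bs"
  shows "qf_equiv M as bs"
proof (cases "\<beta> = 0")
  case False
  then have "0 < \<beta>" using not_less_zero_ordinal[of \<beta>] by simp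
  then obtain c d where "bf_equiv M 0 (as @ [c]) (bs @ [d])"
    using bf_equiv_forth[OF assms(1)] assms(2) by blast
  then have equiv: "qf_equiv M (as @ [c]) (bs @ [d])" by (simp add: bf_equiv.simps)
  have trm: "wf_trm S (Suc n) t \<and> trm_val M (xs @ [x]) t = trm_val M xs t"
    if "wf_trm S n t" "n = length xs" for S n t xs and x :: 'b
    using that by (induction t) (auto simp: nth_append)
  have "wf_qf S (Suc n) \<phi> \<and> (sat M (xs @ [x]) \<phi> \<longleftrightarrow> sat M xs \<phi>)"
    if "wf_qf S n \<phi>" "n = length xs" for S n \<phi> xs and x :: 'b
    using that by (induction \<phi>) (auto simp: trm)
  then show ?thesis
    using equiv assms(3) unfolding qf_equiv_def by (metis length_append_singleton)
qed (use assms in \<open>simp add: bf_equiv.simps\<close>)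


section \<open>Automorphisms\<close>

lemma trm_val_automorphism:
  assumes "automorphism M h" "as \<in> lists (univ M)" "\<forall>i\<in>syms M. \<forall>x\<in>univ M. app M i x \<in> univ M"
    and "wf_trm (syms M) (length as) t"
  shows "trm_val M as t \<in> univ M \<and> trm_val M (map h as) t = h (trm_val M as t)"
  using assms(4)
proof (induction t)
  case (Var j)
  then show ?case using assms(2) by auto
next
  case (App i t)
  then show ?case using assms(1,3) by (auto simp: automorphism_def)
qed

text \<open>A move is answered by its image or its preimage under \<open>h\<close>.\<close>

lemma automorphism_imp_bf_equiv:
  assumes h: "automorphism M h" and clos: "\<forall>i\<in>syms M. \<forall>x\<in>univ M. app M i x \<in> univ M"
    and "as \<in> lists (univ M)"
  shows "bf_equiv M \<beta> as (map h as)"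
  using assms(3)
proof (induction \<beta> arbitrary: as rule: less_induct)
  case (less \<beta>)
  have bij: "bij_betw h (univ M) (univ M)" using h by (simp add: automorphism_def)
  show ?case
  proof (cases "\<beta> = 0")
    case True
    note trm = trm_val_automorphism[OF h less.prems clos]
    have "sat M as \<phi> \<longleftrightarrow> sat M (map h as) \<phi>" if "wf_qf (syms M) (length as) \<phi>" for \<phi>
      using that
    proof (induction \<phi>)
      case (Eq s t)
      then show ?case
        using trm[of s] trm[of t] bij by (auto simp: bij_betw_def dest: inj_onD)
    qed auto
    with True show ?thesis by (simp add: bf_equiv.simps qf_equiv_def)
  next
    case False
    have step: "bf_equiv M \<gamma> (as @ [c]) (map h as @ [h c])" if "\<gamma> < \<beta>" "c \<in> univ M" for \<gamma> c
      using less.IH[OF that(1), of "as @ [c]"] less.prems that(2) by simp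
    have "\<exists>c\<in>univ M. d = h c" if "d \<in> univ M" for d
      using bij that by (auto simp: bij_betw_def)
    moreover have "h c \<in> univ M" if "c \<in> univ M" for c
      using bij that by (auto simp: bij_betw_def)
    ultimately show ?thesis
      using False step by (subst bf_equiv.simps) (simp, metis)
  qed
qed

section \<open>Tree rank and Scott rank\<close>

text \<open>Recursion is on the ordinal because the tree may be ill-founded. Thus the notion also
  covers nodes of rank \<infinity>, which satisfy it for every \<open>\<beta>\<close>.\<close>

function rank_ge :: "nat list set \<Rightarrow> nat list \<Rightarrow> ordinal \<Rightarrow> bool" where
  "rank_ge T t \<beta> \<longleftrightarrow>
     (\<forall>\<gamma>. \<gamma> < \<beta> \<longrightarrow> (\<exists>s\<in>successors T t. rank_ge T s \<gamma>))"
  by pat_completeness auto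
termination
  by (relation "inv_image {(\<gamma>, \<beta>). \<gamma> < \<beta>} (\<lambda>(T, t, \<beta>). \<beta>)") (auto intro: wf)

declare rank_ge.simps [simp del]

lemma rank_geD: "rank_ge T t \<beta> \<Longrightarrow> \<gamma> < \<beta> \<Longrightarrow> \<exists>s\<in>successors T t. rank_ge T s \<gamma>"
  by (subst (asm) rank_ge.simps) blast

lemma rank_ge_mono: "rank_ge T t \<beta> \<Longrightarrow> \<gamma> \<le> \<beta> \<Longrightarrow> rank_ge T t \<gamma>"
  by (subst rank_ge.simps) (meson less_le_trans rank_geD)

lemma has_rank_imp_rank_ge_iff:
  assumes "has_rank T t \<alpha>"
  shows "rank_ge T t \<beta> \<longleftrightarrow> \<beta> \<le> \<alpha>"
  using assms
proof (induction arbitrary: \<beta>)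
  case (1 \<sigma> r \<alpha>)
  show ?case
  proof
    assume ge: "rank_ge T \<sigma> \<beta>"
    show "\<beta> \<le> \<alpha>"
    proof (rule ccontr)
      assume "\<not> \<beta> \<le> \<alpha>"
      then have "\<alpha> < \<beta>" by simp
      from rank_geD[OF ge this] obtain s where s: "s \<in> successors T \<sigma>" "rank_ge T s \<alpha>"
        by blast
      with 1 have "\<alpha> \<le> r s" "r s < \<alpha>" by blast+
      then show False by simp
    qed
  next
    assume le: "\<beta> \<le> \<alpha>"
    show "rank_ge T \<sigma> \<beta>"
    proof (subst rank_ge.simps, intro allI impI)
      fix \<gamma> assume "\<gamma> < \<beta>"
      \<comment> \<open>Minimality of \<open>\<alpha>\<close>: the smaller \<open>\<gamma>\<close>
        is no strict bound for the successor ranks, so some successor has rank at least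
        \<open>\<gamma>\<close>.\<close>
      with le have "\<not> \<alpha> \<le> \<gamma>" by simp
      with 1 obtain s where "s \<in> successors T \<sigma>" "\<not> r s < \<gamma>" by blast
      with 1 show "\<exists>s\<in>successors T \<sigma>. rank_ge T s \<gamma>" by (metis not_less)
    qed
  qed
qed

lemma has_rank_unique: "has_rank T t \<alpha> \<Longrightarrow> has_rank T t \<beta> \<Longrightarrow> \<alpha> = \<beta>"
  using has_rank_imp_rank_ge_iff by (metis antisym order_refl)

section \<open>Ranked and unranked nodes, lifting to the next level\<close>

lemma countable_ranks: "countable {\<alpha>. \<exists>\<sigma>\<in>T. has_rank T \<sigma> \<alpha>}"
proof -
  have "{\<alpha>. \<exists>\<sigma>\<in>T. has_rank T \<sigma> \<alpha>} \<subseteq> range (\<lambda>\<sigma>. THE \<alpha>. has_rank T \<sigma> \<alpha>)"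
    by (auto simp: image_iff intro!: exI the_equality[symmetric] dest: has_rank_unique)
  then show ?thesis by (rule countable_subset) simp
qed

text \<open>If all successors had ordinal ranks, these countably many ranks would have a least
  strict upper bound among the countable ordinals, and this would rank the node.\<close>

lemma unranked_successor:
  assumes "\<sigma> \<in> T" "\<not> (\<exists>\<alpha>. has_rank T \<sigma> \<alpha>)"
  shows "\<exists>\<tau>\<in>successors T \<sigma>. \<not> (\<exists>\<alpha>. has_rank T \<tau> \<alpha>)"
proof (rule ccontr)
  assume "\<not> ?thesis"
  then obtain r where r: "\<And>\<tau>. \<tau> \<in> successors T \<sigma> \<Longrightarrow> has_rank T \<tau> (r \<tau>)" by metis
  let ?P = "\<lambda>\<beta>. \<forall>\<tau>\<in>successors T \<sigma>. r \<tau> < \<beta>"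
  have "countable (r ` successors T \<sigma>)" by simp
  then obtain \<beta> where "?P \<beta>" by (rule countable_strictly_bounded) auto
  then have "?P (LEAST \<beta>. ?P \<beta>)" by (rule LeastI)
  then have "has_rank T \<sigma> (LEAST \<beta>. ?P \<beta>)"
    using assms(1) r by (intro has_rank.intros[where r = r]) (auto intro: Least_le)
  with assms(2) show False by blast
qed

text \<open>One child is chosen for each node of \<open>d\<close>, so no cancellation occurs and the
  result projects back to \<open>d\<close>. It serves both infinite lifts through unranked nodes and
  finite climbs that consume rank.\<close>

lemma extend_level:
  assumes d: "d \<in> G T" and P: "\<And>t. t \<in> snd d \<Longrightarrow> P t"
    and step: "\<And>t. t \<in> T \<Longrightarrow> P t \<Longrightarrow> \<exists>s\<in>successors T t. Q s"
  obtains d' where "d' \<in> G T" "fst d' = Suc (fst d)" "gop (fst d, {}) d' = d" "\<And>s. s \<in> snd d' \<Longrightarrow> Q s"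
proof -
  have "\<forall>t\<in>snd d. \<exists>s\<in>successors T t. Q s"
    using d P step by (auto simp: G_iff level_def)
  then obtain e where e: "\<And>t. t \<in> snd d \<Longrightarrow> e t \<in> successors T t \<and> Q (e t)" by metis
  then have e': "e t \<in> T" "butlast (e t) = t" "length (e t) = Suc (length t)" if "t \<in> snd d" for t
    using that by (fastforce simp: successors_def)+
  let ?d' = "(Suc (fst d), e ` snd d)"
  have d': "?d' \<in> G T" using d e' by (auto simp: G_iff level_def)
  have "gop (fst d, {}) ?d' = gpred ?d'"
    using G_gfin[OF d'] by (simp add: gop_id gres_def)
  also have "\<dots> = d"
    using d e'(2) branch_sum_image[of "snd d" e] G_gfin[OF d']
    by (auto simp: gpred_eq G_iff prod_eq_iff simp del: gpred.simps)
  finally show thesis using that[OF d'] e by auto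
qed

text \<open>Playing the identity of the next level forces the opponent to lift the translating element by one level.\<close>

lemma bf_equiv_imp_rank_ge:
  assumes tree: "is_tree T"
    and "as \<in> lists (G T)" "bs \<in> lists (G T)" "length as = length bs" "J < length as"
    and "\<And>a. a \<in> set as \<Longrightarrow> fst a \<le> fst (as ! J)"
    and "bf_equiv (tree_struct T) \<beta> as bs" "t \<in> snd (gop (as ! J) (bs ! J))"
  shows "rank_ge T t \<beta>"
  using assms(2-)
proof (induction \<beta> arbitrary: as bs J t rule: less_induct)
  case (less \<beta>)
  let ?M = "tree_struct T" and ?N = "fst (as ! J)"
  have aJ: "as ! J \<in> G T" and bJ: "bs ! J \<in> G T" using less.prems by auto
  show ?case
  proof (subst rank_ge.simps, intro allI impI)
    fix \<gamma> assume \<gamma>: "\<gamma> < \<beta>"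
    let ?c = "(Suc ?N, {}) :: gelt"
    obtain e where e: "e \<in> G T" "bf_equiv ?M \<gamma> (as @ [?c]) (bs @ [e])"
      using bf_equiv_forth[OF less.prems(6) \<gamma>, of ?c] by auto
    \<comment> \<open>The appended identity has the largest level in the extended tuple and becomes
      the new reference entry.\<close>
    let ?J = "length as"
    have ext: "as @ [?c] \<in> lists (G T)" "bs @ [e] \<in> lists (G T)" "?J < length (as @ [?c])"
      "length (as @ [?c]) = length (bs @ [e])" "(as @ [?c]) ! ?J = ?c" "(bs @ [e]) ! ?J = e"
      using less.prems e by (auto simp: nth_append)
    have max: "fst a \<le> fst ((as @ [?c]) ! ?J)" if "a \<in> set (as @ [?c])" for a
      using that less.prems(5)[of a] ext(5) by auto
    have qf: "qf_equiv ?M (as @ [?c]) (bs @ [e])"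
      using e(2) by (rule bf_equiv_imp_qf_equiv) (use ext in auto)
    have fst_e: "fst e = Suc ?N" and tr: "bs @ [e] = map (gop (gop ?c e)) (as @ [?c])"
      using qf_equiv_imp_translate[OF tree ext(1-3) max qf] unfolding ext(5,6) by auto
    let ?d = "gop ?c e"
    have d: "?d \<in> G T" "fst ?d = Suc ?N" using e fst_e by (auto intro: gop_in_G[OF tree])
    have "bs ! J = gop ?d (as ! J)"
      using arg_cong[OF tr, of "\<lambda>xs. xs ! J"] less.prems(3,4) by (simp add: nth_append)
    \<comment> \<open>The new translation \<open>?d\<close> also carries \<open>as ! J\<close> to
      \<open>bs ! J\<close>. So the old difference is the predecessor of \<open>?d\<close>, and each
      of its nodes has a child in \<open>?d\<close>.\<close>
    then have "gop (as ! J) (bs ! J) = gop (?N, {}) ?d"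
      using aJ d(1) by (simp add: gop_left_commute[of "as ! J"] G_gfin gop_self) (rule gop_commute)
    also have "\<dots> = gpred ?d"
      using d by (simp add: gop_id G_gfin gres_def)
    finally have "t \<in> snd (gpred ?d)" using less.prems(7) by simp
    then have "t \<in> branch_sum (snd ?d)"
      by (simp add: gpred_eq[OF G_gfin[OF d(1)]] split: if_splits)
    then obtain s where s: "s \<in> snd ?d" "t = butlast s" using branch_sum_subset by blast
    have "s \<in> T" "length s = Suc ?N" using s d by (auto simp: G_iff level_def)
    then have "s \<in> successors T t"
      using s(2) by (auto simp: successors_def intro!: exI[of _ "last s"]) (metis append_butlast_last_id list.size(3) nat.distinct(1))
    moreover have "rank_ge T s \<gamma>"
      using less.IH[OF \<gamma> ext(1,2,4,3) max e(2), of s] s(1) unfolding ext(5,6) by simp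
    ultimately show "\<exists>s\<in>successors T t. rank_ge T s \<gamma>" by blast
  qed
qed

text \<open>Unranked nodes have unranked successors, so \<open>d\<close> lifts level by level to an
  infinite coherent sequence; translation by this sequence is the automorphism.\<close>

lemma unranked_imp_automorphism:
  assumes tree: "is_tree T" and d: "d \<in> G T" and unranked: "\<And>t. t \<in> snd d \<Longrightarrow> \<not> (\<exists>\<alpha>. has_rank T t \<alpha>)"
  shows "\<exists>h. automorphism (tree_struct T) h \<and> (\<forall>x\<in>G T. fst x \<le> fst d \<longrightarrow> h x = gop d x)"
proof -
  define good where "good n e \<longleftrightarrow> e \<in> G T \<and> fst e = fst d + n \<and> (\<forall>t\<in>snd e. \<not> (\<exists>\<alpha>. has_rank T t \<alpha>))" for n e
  have step: "\<exists>e'. good (Suc n) e' \<and> gop (fst e, {}) e' = e" if "good n e" for n e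
  proof -
    have "e \<in> G T" "\<And>t. t \<in> snd e \<Longrightarrow> \<not> (\<exists>\<alpha>. has_rank T t \<alpha>)"
      using that by (auto simp: good_def)
    from extend_level[where P = "\<lambda>t. \<not> (\<exists>\<alpha>. has_rank T t \<alpha>)", OF this unranked_successor]
    obtain e' where "e' \<in> G T" "fst e' = Suc (fst e)" "gop (fst e, {}) e' = e"
      "\<forall>s\<in>snd e'. \<not> (\<exists>\<alpha>. has_rank T s \<alpha>)" by metis
    with that show ?thesis unfolding good_def by (intro exI[of _ e']) simp
  qed
  have "good 0 d" using d unranked by (simp add: good_def)
  then have "\<exists>q. \<forall>n. (good n (q n) \<and> (n = 0 \<longrightarrow> q n = d)) \<and> gop (fst (q n), {}) (q (Suc n)) = q n"
    using step by (intro dependent_nat_choice) blast+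
  then obtain q where q0: "q 0 = d" and q: "\<And>n. good n (q n)"
    and q_Suc: "\<And>n. gop (fst (q n), {}) (q (Suc n)) = q n" by blast
  have qG: "q n \<in> G T" and qfst: "fst (q n) = fst d + n" for n using q by (auto simp: good_def)
  have coherent: "gop (q (n + k)) x = gop (q n) x" if "x \<in> G T" "fst x \<le> fst d + n" for n k x
  proof (induction k)
    case (Suc k)
    have "gop (q (Suc (n + k))) x = gop (q (n + k)) x"
      by (rule gop_eqI_of_res[OF _ _ q_Suc]) (use that qG qfst in \<open>auto intro: G_gfin\<close>)
    with Suc show ?case by simp
  qed simp
  \<comment> \<open>The term \<open>q (fst x)\<close> has level \<open>fst d + fst x\<close>, high
    enough to act on \<open>x\<close> without lowering its level. By coherence, every term of
    sufficient level gives the same value.\<close>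
  define h where "h x = gop (q (fst x)) x" for x
  have h_eq: "h x = gop (q n) x" if "x \<in> G T" "fst x \<le> fst d + n" for n x
    using coherent[OF that(1), of "fst x" "n - fst x"] coherent[OF that, of "fst x - n"]
    unfolding h_def by (cases "fst x \<le> n") auto
  have hG: "h x \<in> G T" "fst (h x) = fst x" if "x \<in> G T" for x
    using that qG qfst by (auto simp: h_def intro: gop_in_G[OF tree])
  have hh: "h (h x) = x" if "x \<in> G T" for x
    using hG[OF that] that qfst[of "fst x"] unfolding h_def by (simp add: gop_cancel G_gfin[OF qG] G_gfin)
  have "bij_betw h (G T) (G T)"
    by (rule bij_betw_byWitness[of _ h]) (auto simp: hh hG)
  moreover have "h (gop i x) = gop i (h x)" if "i \<in> G T" "x \<in> G T" for i x
  proof -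
    have "h (gop i x) = gop (q (fst x)) (gop i x)"
      by (rule h_eq) (use that in \<open>auto intro: gop_in_G[OF tree]\<close>)
    then show ?thesis using that by (simp add: h_def gop_left_commute G_gfin[OF qG] G_gfin)
  qed
  ultimately have "automorphism (tree_struct T) h" by (simp add: automorphism_def)
  then show ?thesis using h_eq[of _ 0] q0 by auto
qed

text \<open>
  One move may climb any finite number of levels, so an equivalence of order \<open>\<alpha>\<close> costs
  \<open>\<omega> \<cdot> \<alpha>\<close> in rank.
\<close>

lemma rank_ge_imp_bf_equiv:
  assumes tree: "is_tree T" and R: "Well_order R"
    and "a \<in> Field R" "d \<in> G T" "as \<in> lists (G T)" "\<And>x. x \<in> set as \<Longrightarrow> fst x \<le> fst d"
    and "\<And>t. t \<in> snd d \<Longrightarrow> rank_ge T t (seg (omega_times R) (prod_encode (a, 0)))"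
  shows "bf_equiv (tree_struct T) (seg R a) as (map (gop d) as)"
  using assms(3-)
proof (induction "seg R a" arbitrary: a as d rule: less_induct)
  case less
  let ?M = "tree_struct T"
  let ?o = "\<lambda>a k. seg (omega_times R) (prod_encode (a, k))"
  note wo = Well_order_omega_times[OF R]
  show ?case
  proof (cases "seg R a = 0")
    case True
    then show ?thesis
      using translate_imp_qf_equiv[OF tree less.prems(2-4)] by (simp add: bf_equiv.simps)
  next
    case False
    \<comment> \<open>Here \<open>m\<close> is the level of the move to be answered. One lift
      \<open>d'\<close> of \<open>d\<close> to a level at least \<open>m\<close> serves both
      directions.\<close>
    have ext: "\<exists>d'\<in>G T. m \<le> fst d' \<and> (\<forall>x\<in>set as. gop d' x = gop d x) \<and>
        (\<forall>c\<in>G T. fst c \<le> fst d' \<longrightarrow> bf_equiv ?M \<delta> (as @ [c]) (map (gop d) as @ [gop d' c]))"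
      if \<delta>: "\<delta> < seg R a" for \<delta> m
    proof -
      have "\<delta> < abs_ordinal R" using \<delta> seg_less_abs_ordinal[OF R less.prems(1)] by simp
      then obtain b where b: "b \<in> Field R" "\<delta> = seg R b" using R by (rule less_abs_ordinalE)
      have ba: "(b, a) \<in> R" "b \<noteq> a"
      proof -
        show "b \<noteq> a" using \<delta> b by auto
        have "(a, b) \<notin> R" using seg_strict_mono[OF R, of a b] \<delta> b by (metis less_asym less_irrefl)
        then show "(b, a) \<in> R"
          using wo_rel.TOTALS[of R] R b less.prems(1) by (auto simp: wo_rel_def)
      qed
      \<comment> \<open>For \<beta> the ordinal \<open>seg R b\<close>, the ordinal
        \<open>?o b k\<close> is \<omega> \<cdot> \<beta> + k. All of these lie below
        \<open>?o a 0\<close>, so the rank available suffices for any finite climb.\<close>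
      have o_Suc: "?o b k < ?o b (Suc k)" for k
        by (rule seg_strict_mono[OF wo]) (auto intro: omega_times_coded[OF R] b)
      have o_less: "?o b k < ?o a 0" for k
        by (rule seg_strict_mono[OF wo]) (use ba in \<open>auto intro: omega_times_coded[OF R]\<close>)
      \<comment> \<open>Each level climbed lowers the guaranteed rank by one successor step, from
        \<open>?o b k\<close> down to \<open>?o b 0\<close>, the rank that the induction hypothesis
        for \<open>b\<close> demands.\<close>
      have climb: "\<exists>d'\<in>G T. fst d' = fst e + k \<and> gop (fst e, {}) d' = e \<and> (\<forall>t\<in>snd d'. rank_ge T t (?o b 0))"
        if "e \<in> G T" "\<And>t. t \<in> snd e \<Longrightarrow> rank_ge T t (?o b k)" for e k
        using that
      proof (induction k arbitrary: e)
        case 0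
        then show ?case by (intro bexI[of _ e]) (auto simp: gop_id_absorb G_gfin)
      next
        case (Suc k)
        have "\<exists>s\<in>successors T t. rank_ge T s (?o b k)" if "t \<in> T" "rank_ge T t (?o b (Suc k))" for t
          using that(2) o_Suc by (rule rank_geD)
        with Suc.prems obtain e' where e': "e' \<in> G T" "fst e' = Suc (fst e)" "gop (fst e, {}) e' = e"
          "\<And>s. s \<in> snd e' \<Longrightarrow> rank_ge T s (?o b k)"
          by (rule extend_level[where P = "\<lambda>t. rank_ge T t (?o b (Suc k))"]) auto
        from Suc.IH[OF e'(1,4)] obtain d' where d': "d' \<in> G T" "fst d' = fst e' + k"
          "gop (fst e', {}) d' = e'" "\<forall>t\<in>snd d'. rank_ge T t (?o b 0)" by blast
        have "gop (fst e, {}) d' = gop d' (fst e, {})" by (rule gop_commute)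
        also have "\<dots> = gop e' (fst e, {})"
          by (rule gop_eqI_of_res[OF _ _ d'(3)]) (use d' e' in \<open>auto intro: G_gfin\<close>)
        also have "\<dots> = e" using e'(3) by (simp add: gop_commute)
        finally show ?case using d' e' by (intro bexI[of _ d']) auto
      qed
      have "rank_ge T t (?o b m)" if "t \<in> snd d" for t
        using less.prems(5)[OF that] o_less by (meson less_imp_le rank_ge_mono)
      from climb[OF less.prems(2) this] obtain d' where d': "d' \<in> G T" "fst d' = fst d + m"
        "gop (fst d, {}) d' = d" "\<forall>t\<in>snd d'. rank_ge T t (?o b 0)" by blast
      have same: "gop d' x = gop d x" if "x \<in> set as" for x
        by (rule gop_eqI_of_res[OF _ _ d'(3)]) (use that d' less.prems in \<open>auto intro: G_gfin\<close>)
      have "bf_equiv ?M \<delta> (as @ [c]) (map (gop d') (as @ [c]))" if "c \<in> G T" "fst c \<le> fst d'" for c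
        unfolding b(2)
      proof (rule less.hyps)
        show "seg R b < seg R a" using \<delta> b by simp
        show "fst x \<le> fst d'" if "x \<in> set (as @ [c])" for x
          using that less.prems(4)[of x] \<open>fst c \<le> fst d'\<close> d'(2) by auto
      qed (use that d' b less.prems in auto)
      then show ?thesis using d' same by (intro bexI[of _ d']) (auto cong: map_cong)
    qed
    show ?thesis
    proof (subst bf_equiv.simps, simp only: False if_False, intro allI impI conjI ballI)
      fix \<delta> c assume "\<delta> < seg R a" and c: "c \<in> univ ?M"
      from ext[OF this(1), of "fst c"] c
      show "\<exists>e\<in>univ ?M. bf_equiv ?M \<delta> (as @ [c]) (map (gop d) as @ [e])"
        by (auto intro: gop_in_G[OF tree])
    next
      fix \<delta> e assume "\<delta> < seg R a" and e: "e \<in> univ ?M"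
      from ext[OF this(1), of "fst e"] obtain d' where d': "d' \<in> G T" "fst e \<le> fst d'"
        "\<And>c. c \<in> G T \<Longrightarrow> fst c \<le> fst d' \<Longrightarrow> bf_equiv ?M \<delta> (as @ [c]) (map (gop d) as @ [gop d' c])"
        by blast
      \<comment> \<open>Translation by \<open>d'\<close> is an involution on the levels concerned,
        so the preimage answering \<open>e\<close> is \<open>gop d' e\<close>.\<close>
      have "gop d' e \<in> G T" using d' e by (auto intro: gop_in_G[OF tree])
      with d'(3)[OF this] d'(1,2) e
      show "\<exists>c\<in>univ ?M. bf_equiv ?M \<delta> (as @ [c]) (map (gop d) as @ [e])"
        by (intro bexI[of _ "gop d' e"]) (auto simp: gop_cancel G_gfin)
    qed
  qed
qed

text \<open>For a nonempty tuple \<open>n\<close> is its maximal level. Equivalence of order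
  \<open>\<beta>\<close> makes every node of the translating element have rank at least
  \<open>\<beta>\<close>; since \<open>\<beta>\<close> strictly bounds the ordinal ranks of level
  \<open>n\<close>, these nodes are unranked and the translation extends to an automorphism.\<close>

lemma bf_equiv_imp_orbit:
  assumes tree: "is_tree T" and as: "as \<in> lists (G T)"
  obtains n where "\<And>\<beta> bs. (\<And>\<sigma> \<alpha>. \<sigma> \<in> level T n \<Longrightarrow> has_rank T \<sigma> \<alpha> \<Longrightarrow> \<alpha> < \<beta>) \<Longrightarrow>
    bs \<in> lists (G T) \<Longrightarrow> length bs = length as \<Longrightarrow> bf_equiv (tree_struct T) \<beta> as bs \<Longrightarrow>
    \<exists>h. automorphism (tree_struct T) h \<and> bs = map h as"
proof (cases "as = []")
  case True
  have "automorphism (tree_struct T) id" by (simp add: automorphism_def)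
  with True that show thesis by auto
next
  case False
  let ?M = "tree_struct T"
  have "Max (fst ` set as) \<in> fst ` set as" using False by (intro Max_in) auto
  then obtain a where "a \<in> set as" "Max (fst ` set as) = fst a" by (rule imageE) simp
  then obtain J where J: "J < length as" "Max (fst ` set as) = fst (as ! J)"
    unfolding in_set_conv_nth by blast
  have max: "fst a \<le> fst (as ! J)" if "a \<in> set as" for a
    unfolding J(2)[symmetric] using that by (intro Max_ge) auto
  show thesis
  proof (rule that[of "fst (as ! J)"])
    fix \<beta> bs
    assume bound: "\<And>\<sigma> \<alpha>. \<sigma> \<in> level T (fst (as ! J)) \<Longrightarrow> has_rank T \<sigma> \<alpha> \<Longrightarrow> \<alpha> < \<beta>"
      and bs: "bs \<in> lists (G T)" and len: "length bs = length as" and eq: "bf_equiv ?M \<beta> as bs"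
    have qf: "qf_equiv ?M as bs"
      using eq by (rule bf_equiv_imp_qf_equiv) (simp_all add: len G_nonempty)
    define d where "d = gop (as ! J) (bs ! J)"
    have tr: "fst (bs ! J) = fst (as ! J)" "bs = map (gop d) as"
      using qf_equiv_imp_translate[OF tree as bs J(1) max qf] unfolding d_def by auto
    have d: "d \<in> G T" "fst d = fst (as ! J)"
      using as bs J len tr(1) by (auto simp: d_def intro: gop_in_G[OF tree])
    have "\<not> (\<exists>\<alpha>. has_rank T t \<alpha>)" if t: "t \<in> snd d" for t
    proof
      assume "\<exists>\<alpha>. has_rank T t \<alpha>"
      then obtain \<alpha> where \<alpha>: "has_rank T t \<alpha>" ..
      have "rank_ge T t \<beta>"
        using bf_equiv_imp_rank_ge[OF tree as bs len[symmetric] J(1) max eq] t unfolding d_def by blast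
      then have "\<beta> \<le> \<alpha>" using has_rank_imp_rank_ge_iff[OF \<alpha>] by simp
      moreover have "t \<in> level T (fst (as ! J))" using t d by (auto simp: G_iff)
      ultimately show False using bound[OF _ \<alpha>] by (meson not_le)
    qed
    from unranked_imp_automorphism[OF tree d(1) this] obtain h where
      h: "automorphism ?M h" "\<And>x. x \<in> G T \<Longrightarrow> fst x \<le> fst d \<Longrightarrow> h x = gop d x" by blast
    have "map (gop d) as = map h as" using h(2) as max d(2) by (auto simp: map_eq_conv)
    with h(1) tr(2) show "\<exists>h. automorphism ?M h \<and> bs = map h as" by auto
  qed
qed

text \<open>An automorphism would give equivalence of every order, in particular of one beyond
  \<open>\<rho>\<close>, and hence push the rank of \<open>t\<close> above
  \<open>\<rho>\<close>.\<close>

lemma translate_not_in_orbit: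
  assumes tree: "is_tree T" and d: "(n, {t}) \<in> G T" and rank: "has_rank T t \<rho>"
  shows "\<not> (automorphism (tree_struct T) h \<and> h (n, {}) = (n, {t}))"
proof
  assume h: "automorphism (tree_struct T) h \<and> h (n, {}) = (n, {t})"
  obtain \<rho>' where "\<rho> < \<rho>'" using countable_strictly_bounded[of "{\<rho>}"] by auto
  have "bf_equiv (tree_struct T) \<rho>' [(n, {})] (map h [(n, {})])"
    by (rule automorphism_imp_bf_equiv) (use h in \<open>auto intro: gop_in_G[OF tree]\<close>)
  then have "bf_equiv (tree_struct T) \<rho>' [(n, {})] [(n, {t})]" using h by simp
  then have "rank_ge T t \<rho>'"
    by (rule bf_equiv_imp_rank_ge[OF tree, where J = 0, rotated 5])
      (use d in \<open>auto simp: gop_id_absorb G_gfin\<close>)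
  with rank \<open>\<rho> < \<rho>'\<close> show False by (simp add: has_rank_imp_rank_ge_iff)
qed

text \<open>If the Scott rank were a smaller ordinal \<open>seg R a\<close>, the rank of
  \<open>t\<close> would make \<open>[(n, {})]\<close> and \<open>[(n, {t})]\<close> equivalent to
  that order, although they lie in different orbits. The premise \<open>attained\<close> ensures
  that the \<open>LEAST\<close> defining the Scott rank is attained.\<close>

lemma tuple_scott_rank_ge:
  assumes tree: "is_tree T" and R: "Well_order R" and d: "(n, {t}) \<in> G T"
    and rank: "has_rank T t \<rho>" "abs_ordinal (omega_times R) \<le> \<rho>"
    and attained: "\<And>bs. bs \<in> lists (G T) \<Longrightarrow> length bs = length [(n, {})] \<Longrightarrow>
      bf_equiv (tree_struct T) \<beta> [(n, {})] bs \<Longrightarrow> \<exists>h. automorphism (tree_struct T) h \<and> bs = map h [(n, {})]"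
  shows "abs_ordinal R \<le> tuple_scott_rank (tree_struct T) [(n, {})]"
proof (rule ccontr)
  let ?M = "tree_struct T" and ?S = "tuple_scott_rank (tree_struct T) [(n, {})]"
  let ?P = "\<lambda>\<beta>. \<forall>bs \<in> lists (univ ?M). length bs = length [(n, {}) :: gelt] \<longrightarrow>
     bf_equiv ?M \<beta> [(n, {})] bs \<longrightarrow> (\<exists>h. automorphism ?M h \<and> bs = map h [(n, {})])"
  assume "\<not> abs_ordinal R \<le> ?S"
  then have "?S < abs_ordinal R" by simp
  then obtain a where a: "a \<in> Field R" "?S = seg R a" using R by (rule less_abs_ordinalE)
  have "?P \<beta>" using attained by auto
  then have orbit: "?P ?S" unfolding tuple_scott_rank_def by (rule LeastI)
  have "seg (omega_times R) (prod_encode (a, 0)) < abs_ordinal (omega_times R)"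
    using Well_order_omega_times[OF R] by (rule seg_less_abs_ordinal) (simp add: Field_omega_times R a)
  then have "rank_ge T t (seg (omega_times R) (prod_encode (a, 0)))"
    using rank by (simp add: has_rank_imp_rank_ge_iff)
  then have "bf_equiv ?M (seg R a) [(n, {})] (map (gop (n, {t})) [(n, {})])"
    using d a by (intro rank_ge_imp_bf_equiv[OF tree R]) auto
  then have "bf_equiv ?M ?S [(n, {})] [(n, {t})]"
    using d a by (simp add: gop_id_absorb_right G_gfin)
  with bspec[OF orbit, of "[(n, {t})]"] d
  obtain h where "automorphism ?M h" "[(n, {t})] = map h [(n, {})]" by auto
  with translate_not_in_orbit[OF tree d rank(1)] show False by auto
qed

theorem theorem3p7:
  fixes T :: "nat list set"
  assumes "computable_tree T"
    and "\<forall>n. \<exists>\<beta>. computable_ordinal \<beta> \<and> (\<forall>\<sigma> \<in> level T n. \<forall>\<alpha>. has_rank T \<sigma> \<alpha> \<longrightarrow> \<alpha> \<le> \<beta>)"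
    and "\<not> (\<exists>\<beta>. computable_ordinal \<beta> \<and> (\<forall>\<sigma> \<in> T. \<forall>\<alpha>. has_rank T \<sigma> \<alpha> \<longrightarrow> \<alpha> \<le> \<beta>))"
  shows "computable_ustruct gcode gcode (tree_struct T) \<and> scott_rank (tree_struct T) = omega1_CK"
proof
  let ?M = "tree_struct T"
  show "computable_ustruct gcode gcode ?M" using assms(1) by (rule computable_tree_struct)
  have tree: "is_tree T" using assms(1) by (simp add: computable_tree_def)
  obtain \<beta>\<^sub>0 where "\<And>x. x \<in> {\<alpha>. \<exists>\<sigma>\<in>T. has_rank T \<sigma> \<alpha>} \<Longrightarrow> x < \<beta>\<^sub>0"
    using countable_strictly_bounded[OF countable_ranks[of T]] by blast
  with assms(3) have "\<not> computable_ordinal \<beta>\<^sub>0" by (auto intro: less_imp_le)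
  \<comment> \<open>The countably many ranks have a strict bound, which the third assumption forces
    to be non-computable. Thus \<open>omega1_CK\<close> is a genuine minimum.\<close>
  note below_CK = less_omega1_CK_iff[OF this]
  have large: "\<exists>\<sigma>\<in>T. \<exists>\<alpha>. has_rank T \<sigma> \<alpha> \<and> \<beta> < \<alpha>" if "computable_ordinal \<beta>" for \<beta>
    using assms(3) that by (meson not_le)
  \<comment> \<open>The assumed bounds are only weak. A strict computable one comes from a node of
    rank above \<open>\<beta>\<close>: the computable bound for the level of that node exceeds
    \<open>\<beta>\<close>.\<close>
  have level_bound: "\<exists>\<beta>. computable_ordinal \<beta> \<and> (\<forall>\<sigma>\<in>level T n. \<forall>\<alpha>. has_rank T \<sigma> \<alpha> \<longrightarrow> \<alpha> < \<beta>)" for n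
  proof -
    obtain \<beta> where \<beta>: "computable_ordinal \<beta>" "\<forall>\<sigma>\<in>level T n. \<forall>\<alpha>. has_rank T \<sigma> \<alpha> \<longrightarrow> \<alpha> \<le> \<beta>"
      using assms(2) by blast
    obtain \<sigma> \<alpha> where \<sigma>: "\<sigma> \<in> T" "has_rank T \<sigma> \<alpha>" "\<beta> < \<alpha>" using large[OF \<beta>(1)] by blast
    obtain \<beta>' where \<beta>': "computable_ordinal \<beta>'" "\<forall>\<tau>\<in>level T (length \<sigma>). \<forall>\<alpha>. has_rank T \<tau> \<alpha> \<longrightarrow> \<alpha> \<le> \<beta>'"
      using assms(2) by blast
    have "\<sigma> \<in> level T (length \<sigma>)" using \<sigma>(1) by (simp add: level_def)
    with \<beta>'(2) \<sigma>(2) have "\<alpha> \<le> \<beta>'" by blast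
    with \<sigma>(3) have "\<beta> < \<beta>'" by (rule less_le_trans)
    with \<beta>(2) \<beta>'(1) show ?thesis by (meson le_less_trans)
  qed
  have upper: "tuple_scott_rank ?M as < omega1_CK" if "as \<in> lists (univ ?M)" for as
  proof -
    have as: "as \<in> lists (G T)" using that by simp
    obtain n where n: "\<And>\<beta> bs. (\<And>\<sigma> \<alpha>. \<sigma> \<in> level T n \<Longrightarrow> has_rank T \<sigma> \<alpha> \<Longrightarrow> \<alpha> < \<beta>) \<Longrightarrow>
      bs \<in> lists (G T) \<Longrightarrow> length bs = length as \<Longrightarrow> bf_equiv ?M \<beta> as bs \<Longrightarrow>
      \<exists>h. automorphism ?M h \<and> bs = map h as"
      using bf_equiv_imp_orbit[OF tree as] by blast
    obtain \<beta> where \<beta>: "computable_ordinal \<beta>" "\<forall>\<sigma>\<in>level T n. \<forall>\<alpha>. has_rank T \<sigma> \<alpha> \<longrightarrow> \<alpha> < \<beta>"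
      using level_bound by blast
    have "tuple_scott_rank ?M as \<le> \<beta>"
      unfolding tuple_scott_rank_def using n[of \<beta>] \<beta>(2) by (intro Least_le) simp
    with \<beta>(1) show ?thesis using below_CK by (meson le_less_trans)
  qed
  \<comment> \<open>The tuple is the identity of the level of some node whose ordinal rank exceeds
    \<omega> \<cdot> \<alpha>.\<close>
  have lower: "\<exists>as\<in>lists (univ ?M). \<alpha> \<le> tuple_scott_rank ?M as" if \<alpha>: "computable_ordinal \<alpha>" for \<alpha>
  proof -
    obtain R where R: "Well_order R" "computable_rel R" "\<alpha> = abs_ordinal R"
      using \<alpha> by (auto simp: computable_ordinal_def)
    have "computable_ordinal (abs_ordinal (omega_times R))"
      using R Well_order_omega_times computable_rel_omega_times by (auto simp: computable_ordinal_def)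
    moreover obtain \<beta> where \<beta>: "computable_ordinal \<beta>" "\<forall>\<sigma>\<in>level T 0. \<forall>\<alpha>. has_rank T \<sigma> \<alpha> \<longrightarrow> \<alpha> < \<beta>"
      using level_bound by blast
    ultimately have "computable_ordinal (max (abs_ordinal (omega_times R)) \<beta>)"
      by (simp add: max_def)
    \<comment> \<open>The bound \<open>\<beta>\<close> keeps \<open>t\<close> away from the root, since level 0 of the structure is trivial.\<close>
    then obtain t \<rho> where t: "t \<in> T" "has_rank T t \<rho>" "max (abs_ordinal (omega_times R)) \<beta> < \<rho>"
      using large by blast
    have rank: "abs_ordinal (omega_times R) \<le> \<rho>" "\<beta> < \<rho>" using t(3) by auto
    define n where "n = length t"
    have "t \<notin> level T 0" using \<beta>(2) t(2) rank(2) by (meson less_asym)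
    then have d: "(n, {t}) \<in> G T" using t(1) by (auto simp: G_iff level_def n_def)
    have "[(n, {})] \<in> lists (G T)" by simp
    from bf_equiv_imp_orbit[OF tree this] obtain m where
      m: "\<And>\<beta> bs. (\<And>\<sigma> \<alpha>. \<sigma> \<in> level T m \<Longrightarrow> has_rank T \<sigma> \<alpha> \<Longrightarrow> \<alpha> < \<beta>) \<Longrightarrow>
        bs \<in> lists (G T) \<Longrightarrow> length bs = length [(n, {}) :: gelt] \<Longrightarrow> bf_equiv ?M \<beta> [(n, {})] bs \<Longrightarrow>
        \<exists>h. automorphism ?M h \<and> bs = map h [(n, {})]" by blast
    \<comment> \<open>A strict bound for level \<open>m\<close> supplies the order at which
      equivalence already implies lying in the same orbit.\<close>
    obtain \<beta>' where "\<forall>\<sigma>\<in>level T m. \<forall>\<alpha>. has_rank T \<sigma> \<alpha> \<longrightarrow> \<alpha> < \<beta>'"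
      using level_bound by blast
    then have "abs_ordinal R \<le> tuple_scott_rank ?M [(n, {})]"
      using tuple_scott_rank_ge[OF tree R(1) d t(2) rank(1), of \<beta>'] m[of \<beta>'] by blast
    then show ?thesis using R(3) by (intro bexI[of _ "[(n, {})]"]) auto
  qed
  show "scott_rank ?M = omega1_CK"
    unfolding scott_rank_def
  proof (rule Least_equality)
    show "\<forall>as\<in>lists (univ ?M). tuple_scott_rank ?M as < omega1_CK" using upper by blast
    fix \<alpha> assume \<alpha>: "\<forall>as\<in>lists (univ ?M). tuple_scott_rank ?M as < \<alpha>"
    show "omega1_CK \<le> \<alpha>"
    proof (rule ccontr)
      assume "\<not> omega1_CK \<le> \<alpha>"
      then have "computable_ordinal \<alpha>" using below_CK by (meson not_le)
      with lower \<alpha> show False by (meson not_le)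
    qed
  qed
qed

end
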